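(* Let $h\ge 2$ be an integer and let $\{G_n, n=1,2,\dots\}$ be a sequence of finite graphs such that $n_1=n_1(n)=|V(G_n)|\to\infty$ and $n_1\ge 1$. Let $v_n^*$ be chosen uniformly at random from $V(G_n)$, and suppose $(G_n,v_n^* )\xrightarrow{d} G^*$ (local weak convergence), where $G^*$ is a random element of $\mathcal{G}_*$. Write $d_n=d_{G_n}(v_n^* )$ and $d^*=d_{G^*}(r^* )$, where $r^*=\mathrm{root}(G^* )$, and assume $\mathbb{E}\,(d^* )^{h-1}<\infty$. Then the following statements are equivalent: (i) $\mathbb{E}\, d_n^{h-1}\to \mathbb{E}\,(d^* )^{h-1}$; (ii) the sequence $d_n^{h-1}$, $n=1,2,\dots$, is uniformly integrable; (iii) for any connected graph $H$ on $h$ vertices and any $H'\in\mathcal{R}(H)$, $$n_1^{-1}\,\mathrm{emb}(H,G_n)\to \mathbb{E}\,\mathrm{emb}'(H',G^*,r^* ).$$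
   Context: Graphs are simple and undirected; all limits are as $n\to\infty$. A rooted graph is a pair $(H,v)$ with $v\in V(H)$ the root, often denoted just by $H$ with $\mathrm{root}(H)=v$. For a graph $G$ and vertex $v$, $B_r(G,v)$ is the subgraph of $G$ induced on the vertices at distance at most $r$ from $v$, rooted at $v$. A graph is locally finite if all its degrees are finite. $\cong$ denotes root-preserving isomorphism of connected rooted graphs. $\mathcal{G}_*$ is the space of connected locally finite rooted graphs up to $\cong$, with metric $d_{loc}(G_1,G_2)=2^{-\sup\{r:\,B_r(G_1)\cong B_r(G_2)\}}$ and its Borel $\sigma$-algebra. Local weak convergence: for finite graphs $G_n$ with $v_n^*$ uniform on $V(G_n)$, let $\mu_n$ be the law on $\mathcal{G}_*$ of the component of $G_n$ containing $v_n^*$, rooted at $v_n^*$. Then $(G_n,v_n^* )\xrightarrow{d}G^*$ means that $\mu_n$ converges weakly to the law of $G^*$; equivalently $\mathbb{P}(B_r(G_n,v_n^* )\cong H)\to\mathbb{P}(B_r(G^* )\cong H)$ for each integer $r\ge0$ and each connected rooted graph $H$. $d_G(v)$ is the degree of $v$ in $G$. $\mathrm{emb}(H,G)$ is the number of embeddings (injective maps $V(H)\to V(G)$ sending adjacent vertices to adjacent vertices) from $H$ to $G$. For a rooted graph $H'$, $\mathrm{emb}'(H',G,v)$ is the number of embeddings of $H'$ into $G$ that map $\mathrm{root}(H')$ to $v$. $\mathcal{R}(H)$ is the set of all $|V(H)|$ rooted graphs obtained from $H$ by choosing a root. *)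

theory Defs
  imports "HOL-Probability.Probability"
begin

section \<open>Simple graphs\<close>

typedef 'a ugraph =
  "{(V :: 'a set, E :: 'a \<Rightarrow> 'a \<Rightarrow> bool). \<forall>u v. E u v \<longrightarrow> u \<in> V \<and> v \<in> V \<and> u \<noteq> v \<and> E v u}"
  by (rule exI[of _ "({}, \<lambda>_ _. False)"]) simp

setup_lifting type_definition_ugraph

lift_definition verts :: "'a ugraph \<Rightarrow> 'a set" is fst .

lift_definition adj :: "'a ugraph \<Rightarrow> 'a \<Rightarrow> 'a \<Rightarrow> bool" is snd .

lift_definition induce :: "'a ugraph \<Rightarrow> 'a set \<Rightarrow> 'a ugraph" is
  "\<lambda>(V, E) S. (V \<inter> S, \<lambda>u v. E u v \<and> u \<in> S \<and> v \<in> S)"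
  by auto

lift_definition edgeless :: "'a set \<Rightarrow> 'a ugraph" is "\<lambda>V. (V, \<lambda>_ _. False)"
  by auto

text \<open>Loops arising from a non-injective \<open>f\<close> are dropped.\<close>

lift_definition image_graph :: "('a \<Rightarrow> 'b) \<Rightarrow> 'a ugraph \<Rightarrow> 'b ugraph" is
  "\<lambda>f (V, E). (f ` V, \<lambda>a b. a \<noteq> b \<and> (\<exists>u v. E u v \<and> a = f u \<and> b = f v))"
  by force

definition nbrs :: "'a ugraph \<Rightarrow> 'a \<Rightarrow> 'a set" where
  "nbrs G v = {w. adj G v w}"

definition vdeg :: "'a ugraph \<Rightarrow> 'a \<Rightarrow> nat" where
  "vdeg G v = card (nbrs G v)"

definition loc_finite :: "'a ugraph \<Rightarrow> bool" where
  "loc_finite G \<longleftrightarrow> (\<forall>v\<in>verts G. finite (nbrs G v))"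

definition graph_connected :: "'a ugraph \<Rightarrow> bool" where
  "graph_connected G \<longleftrightarrow> verts G \<noteq> {} \<and> (\<forall>u\<in>verts G. \<forall>v\<in>verts G. (adj G)\<^sup>*\<^sup>* u v)"

text \<open>\<open>(adj G ^^ k) u v\<close> says that there is a walk of length \<open>k\<close> from \<open>u\<close> to \<open>v\<close>; the distance
  is \<open>\<infinity>\<close> if there is no walk at all.\<close>

definition gdist :: "'a ugraph \<Rightarrow> 'a \<Rightarrow> 'a \<Rightarrow> enat" where
  "gdist G u v = (INF k\<in>{k. (adj G ^^ k) u v}. enat k)"

definition component :: "'a ugraph \<Rightarrow> 'a \<Rightarrow> 'a ugraph" where
  "component G v = induce G {w \<in> verts G. (adj G)\<^sup>*\<^sup>* v w}"

text \<open>Extensional functions, so that maps agreeing on \<open>verts H\<close> are counted once.\<close>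

definition embeddings :: "'a ugraph \<Rightarrow> 'b ugraph \<Rightarrow> ('a \<Rightarrow> 'b) set" where
  "embeddings H G = {f \<in> verts H \<rightarrow>\<^sub>E verts G.
     inj_on f (verts H) \<and> (\<forall>u v. adj H u v \<longrightarrow> adj G (f u) (f v))}"

definition emb :: "'a ugraph \<Rightarrow> 'b ugraph \<Rightarrow> nat" where
  "emb H G = card (embeddings H G)"


section \<open>Rooted graphs\<close>

type_synonym 'a rgraph = "'a ugraph \<times> 'a"

definition rootings :: "'a ugraph \<Rightarrow> 'a rgraph set" where
  "rootings H = {(H, v) | v. v \<in> verts H}"

definition rooted_emb :: "'a rgraph \<Rightarrow> 'b ugraph \<Rightarrow> 'b \<Rightarrow> nat" where
  "rooted_emb H' G v = card {f \<in> embeddings (fst H') G. f (snd H') = v}"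

definition rball :: "nat \<Rightarrow> 'a rgraph \<Rightarrow> 'a rgraph" where
  "rball r x = (induce (fst x) {w \<in> verts (fst x). gdist (fst x) (snd x) w \<le> enat r}, snd x)"

definition is_rooted_iso :: "('a \<Rightarrow> 'b) \<Rightarrow> 'a rgraph \<Rightarrow> 'b rgraph \<Rightarrow> bool" where
  "is_rooted_iso f x y \<longleftrightarrow> bij_betw f (verts (fst x)) (verts (fst y)) \<and> f (snd x) = snd y \<and>
     (\<forall>u\<in>verts (fst x). \<forall>v\<in>verts (fst x). adj (fst x) u v \<longleftrightarrow> adj (fst y) (f u) (f v))"

definition rooted_iso :: "'a rgraph \<Rightarrow> 'b rgraph \<Rightarrow> bool" where
  "rooted_iso x y \<longleftrightarrow> (\<exists>f. is_rooted_iso f x y)"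

definition clf_rgraph :: "'a rgraph \<Rightarrow> bool" where
  "clf_rgraph x \<longleftrightarrow> snd x \<in> verts (fst x) \<and> graph_connected (fst x) \<and> loc_finite (fst x)"

text \<open>\<open>2\<close> to the power of minus the supremum, read as \<open>0\<close> if the supremum is \<open>\<infinity>\<close>.\<close>

definition dloc :: "'a rgraph \<Rightarrow> 'b rgraph \<Rightarrow> real" where
  "dloc x y = (case (SUP r\<in>{r. rooted_iso (rball r x) (rball r y)}. enat r) of
     enat r \<Rightarrow> 1 / 2 ^ r | \<infinity> \<Rightarrow> 0)"


subsection \<open>Basic facts\<close>

lemma adj_verts: "adj G u v \<Longrightarrow> u \<in> verts G \<and> v \<in> verts G"
  by transfer auto

lemma adj_sym: "adj G u v \<Longrightarrow> adj G v u"
  by transfer auto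

lemma adj_irrefl [simp]: "\<not> adj G u u"
  by transfer (clarsimp, blast)

lemma ugraph_eqI: "verts G = verts H \<Longrightarrow> adj G = adj H \<Longrightarrow> G = H"
  by transfer (auto simp: prod_eq_iff)

lemma verts_induce [simp]: "verts (induce G S) = verts G \<inter> S"
  by transfer auto

lemma adj_induce [simp]: "adj (induce G S) u v \<longleftrightarrow> adj G u v \<and> u \<in> S \<and> v \<in> S"
  by transfer auto

lemma verts_edgeless [simp]: "verts (edgeless V) = V"
  by transfer auto

lemma adj_edgeless [simp]: "\<not> adj (edgeless V) u v"
  by transfer auto

lemma verts_image_graph [simp]: "verts (image_graph f G) = f ` verts G"
  by transfer auto

lemma adj_image_graph_iff:
  "adj (image_graph f G) a b \<longleftrightarrow> a \<noteq> b \<and> (\<exists>u v. adj G u v \<and> a = f u \<and> b = f v)"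
  by transfer (simp only: case_prod_beta snd_conv)

lemma adj_image_graph:
  assumes "inj_on f (verts G)" "u \<in> verts G" "v \<in> verts G"
  shows "adj (image_graph f G) (f u) (f v) \<longleftrightarrow> adj G u v"
proof
  assume "adj (image_graph f G) (f u) (f v)"
  then obtain a b where ab: "adj G a b" "f u = f a" "f v = f b"
    by (auto simp: adj_image_graph_iff)
  then have "u = a" "v = b" using assms adj_verts[OF ab(1)] by (auto dest: inj_onD)
  with ab show "adj G u v" by simp
next
  assume a: "adj G u v"
  then have "f u \<noteq> f v" using assms by (metis adj_irrefl inj_onD)
  with a show "adj (image_graph f G) (f u) (f v)" by (auto simp: adj_image_graph_iff)
qed

lemma relpow_adj_verts: "(adj G ^^ k) u v \<Longrightarrow> u \<in> verts G \<Longrightarrow> v \<in> verts G"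
  by (cases k) (auto dest: adj_verts)

lemma gdist_le_iff: "gdist G u v \<le> enat r \<longleftrightarrow> (\<exists>k\<le>r. (adj G ^^ k) u v)"
proof
  assume *: "gdist G u v \<le> enat r"
  let ?S = "{k. (adj G ^^ k) u v}"
  have ne: "?S \<noteq> {}"
  proof
    assume "?S = {}"
    then have "gdist G u v = \<infinity>" unfolding gdist_def by (simp only: image_empty Inf_enat_def) simp
    with * show False by simp
  qed
  then obtain k0 where "enat k0 \<in> enat ` ?S" by blast
  then have "gdist G u v \<in> enat ` ?S"
    unfolding gdist_def by (rule wellorder_InfI)
  with * show "\<exists>k\<le>r. (adj G ^^ k) u v" by auto
next
  assume "\<exists>k\<le>r. (adj G ^^ k) u v"
  then obtain k where k: "k \<le> r" "(adj G ^^ k) u v" by auto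
  have "gdist G u v \<le> enat k"
    unfolding gdist_def using k by (intro INF_lower) auto
  with k show "gdist G u v \<le> enat r" by (meson enat_ord_simps(1) order_trans)
qed

definition bverts :: "nat \<Rightarrow> 'a rgraph \<Rightarrow> 'a set" where
  "bverts r x = {w \<in> verts (fst x). \<exists>k\<le>r. (adj (fst x) ^^ k) (snd x) w}"

lemma rball_alt: "rball r x = (induce (fst x) (bverts r x), snd x)"
  by (simp add: rball_def bverts_def gdist_le_iff)

lemma bverts_subset: "bverts r x \<subseteq> verts (fst x)"
  by (auto simp: bverts_def)

lemma snd_rball [simp]: "snd (rball r x) = snd x"
  by (simp add: rball_alt)

lemma verts_rball [simp]: "verts (fst (rball r x)) = bverts r x"
  using bverts_subset[of r x] by (auto simp: rball_alt)

lemma adj_rball [simp]: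
  "adj (fst (rball r x)) u v \<longleftrightarrow> adj (fst x) u v \<and> u \<in> bverts r x \<and> v \<in> bverts r x"
  by (simp add: rball_alt)

lemma root_in_bverts: "snd x \<in> verts (fst x) \<Longrightarrow> snd x \<in> bverts r x"
  by (auto simp: bverts_def intro: exI[of _ 0])

lemma bverts_mono: "r \<le> s \<Longrightarrow> bverts r x \<subseteq> bverts s x"
  by (auto simp: bverts_def intro: order_trans)

lemma bverts_0: "snd x \<in> verts (fst x) \<Longrightarrow> bverts 0 x = {snd x}"
  by (auto simp: bverts_def)

lemma relpow_rball:
  assumes "snd x \<in> verts (fst x)" "(adj (fst x) ^^ k) (snd x) w" "k \<le> s"
  shows "(adj (fst (rball s x)) ^^ k) (snd x) w"
  using assms(2,3)
proof (induction k arbitrary: w)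
  case 0
  then show ?case by auto
next
  case (Suc k)
  then obtain z where z: "(adj (fst x) ^^ k) (snd x) z" "adj (fst x) z w" by auto
  have "z \<in> bverts s x"
    using z Suc.prems adj_verts[OF z(2)] by (auto simp: bverts_def intro!: exI[of _ k])
  moreover have "w \<in> bverts s x"
    using Suc.prems adj_verts[OF z(2)] unfolding bverts_def by blast
  ultimately have "z \<in> bverts s x" "w \<in> bverts s x" by auto
  with Suc.IH[of z] z Suc.prems show ?case
    by (auto simp: relcompp_apply)
qed

lemma relpow_rballD: "(adj (fst (rball s x)) ^^ k) u w \<Longrightarrow> (adj (fst x) ^^ k) u w"
  by (induction k arbitrary: w) (auto simp: relcompp_apply)

lemma bverts_rball:
  assumes "snd x \<in> verts (fst x)" "r \<le> s"
  shows "bverts r (rball s x) = bverts r x"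
proof (intro equalityI subsetI)
  fix w assume w: "w \<in> bverts r x"
  obtain k where k: "k \<le> r" "(adj (fst x) ^^ k) (snd x) w"
    using w unfolding bverts_def by blast
  have "w \<in> verts (fst (rball s x))"
    using w bverts_mono[OF assms(2), of x] by auto
  moreover have "(adj (fst (rball s x)) ^^ k) (snd (rball s x)) w"
    using relpow_rball[OF assms(1) k(2), of s] k(1) assms(2) by simp
  ultimately show "w \<in> bverts r (rball s x)"
    using k(1) unfolding bverts_def[of r "rball s x"] by blast
next
  fix w assume w: "w \<in> bverts r (rball s x)"
  obtain k where k: "k \<le> r" "(adj (fst (rball s x)) ^^ k) (snd (rball s x)) w"
    using w unfolding bverts_def by blast
  have "w \<in> verts (fst x)"
    using w bverts_subset[of r "rball s x"] bverts_subset[of s x] by auto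
  moreover have "(adj (fst x) ^^ k) (snd x) w"
    using relpow_rballD[OF k(2)] by simp
  ultimately show "w \<in> bverts r x"
    using k(1) unfolding bverts_def by blast
qed

lemma rball_rball:
  assumes "snd x \<in> verts (fst x)" "r \<le> s"
  shows "rball r (rball s x) = rball r x"
proof (rule prod_eqI)
  show "fst (rball r (rball s x)) = fst (rball r x)"
    using bverts_mono[OF assms(2), of x]
    by (intro ugraph_eqI ext) (auto simp: bverts_rball[OF assms])
qed simp


subsection \<open>Rooted isomorphism\<close>

lemma rooted_iso_refl: "rooted_iso x x"
  unfolding rooted_iso_def is_rooted_iso_def by (rule exI[of _ id]) auto

lemma is_rooted_iso_inv:
  assumes "is_rooted_iso f x y" "snd x \<in> verts (fst x)"
  shows "is_rooted_iso (inv_into (verts (fst x)) f) y x"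
proof -
  let ?g = "inv_into (verts (fst x)) f"
  have b: "bij_betw f (verts (fst x)) (verts (fst y))" and r: "f (snd x) = snd y"
    using assms by (auto simp: is_rooted_iso_def)
  have "bij_betw ?g (verts (fst y)) (verts (fst x))" using b by (rule bij_betw_inv_into)
  moreover have "?g (snd y) = snd x"
    using bij_betw_inv_into_left[OF b assms(2)] r by simp
  moreover have "adj (fst y) u v \<longleftrightarrow> adj (fst x) (?g u) (?g v)"
    if "u \<in> verts (fst y)" "v \<in> verts (fst y)" for u v
  proof -
    have "?g u \<in> verts (fst x)" "?g v \<in> verts (fst x)"
      using that calculation(1) by (auto simp: bij_betw_def)
    then have "adj (fst x) (?g u) (?g v) \<longleftrightarrow> adj (fst y) (f (?g u)) (f (?g v))"
      using assms by (auto simp: is_rooted_iso_def)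
    with that show ?thesis by (simp add: bij_betw_inv_into_right[OF b])
  qed
  ultimately show ?thesis by (auto simp: is_rooted_iso_def)
qed

lemma rooted_iso_sym: "rooted_iso x y \<Longrightarrow> snd x \<in> verts (fst x) \<Longrightarrow> rooted_iso y x"
  unfolding rooted_iso_def using is_rooted_iso_inv by blast

lemma rooted_iso_trans: "rooted_iso x y \<Longrightarrow> rooted_iso y z \<Longrightarrow> rooted_iso x z"
proof -
  assume "rooted_iso x y" "rooted_iso y z"
  then obtain f g where fg: "is_rooted_iso f x y" "is_rooted_iso g y z"
    by (auto simp: rooted_iso_def)
  have "is_rooted_iso (g \<circ> f) x z"
    unfolding is_rooted_iso_def
  proof (intro conjI ballI)
    show "bij_betw (g \<circ> f) (verts (fst x)) (verts (fst z))"
      using fg by (auto simp: is_rooted_iso_def intro: bij_betw_trans)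
    show "(g \<circ> f) (snd x) = snd z"
      using fg by (auto simp: is_rooted_iso_def)
    fix u v assume uv: "u \<in> verts (fst x)" "v \<in> verts (fst x)"
    then have "f u \<in> verts (fst y)" "f v \<in> verts (fst y)"
      using fg(1) by (auto simp: is_rooted_iso_def bij_betw_def)
    with uv show "adj (fst x) u v \<longleftrightarrow> adj (fst z) ((g \<circ> f) u) ((g \<circ> f) v)"
      using fg by (auto simp: is_rooted_iso_def)
  qed
  then show ?thesis by (auto simp: rooted_iso_def)
qed

lemma is_rooted_iso_relpow:
  assumes "is_rooted_iso f x y" "u \<in> verts (fst x)" "(adj (fst x) ^^ k) u w"
  shows "(adj (fst y) ^^ k) (f u) (f w)"
  using assms(3)
proof (induction k arbitrary: w)
  case (Suc k)
  then obtain z where z: "(adj (fst x) ^^ k) u z" "adj (fst x) z w" by auto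
  have "adj (fst y) (f z) (f w)"
    using z(2) adj_verts[OF z(2)] assms(1) by (auto simp: is_rooted_iso_def)
  with Suc.IH[OF z(1)] show ?case by (auto simp: relcompp_apply)
qed auto

lemma is_rooted_iso_bverts:
  assumes f: "is_rooted_iso f x y" and root: "snd x \<in> verts (fst x)"
  shows "f ` bverts r x = bverts r y"
proof
  have b: "bij_betw f (verts (fst x)) (verts (fst y))" and fr: "f (snd x) = snd y"
    using f by (auto simp: is_rooted_iso_def)
  show "f ` bverts r x \<subseteq> bverts r y"
  proof
    fix a assume "a \<in> f ` bverts r x"
    then obtain w k where w: "a = f w" "w \<in> verts (fst x)" "k \<le> r" "(adj (fst x) ^^ k) (snd x) w"
      by (auto simp: bverts_def)
    have "(adj (fst y) ^^ k) (snd y) (f w)"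
      using is_rooted_iso_relpow[OF f root w(4)] fr by simp
    moreover have "f w \<in> verts (fst y)" using b w(2) by (auto simp: bij_betw_def)
    ultimately show "a \<in> bverts r y" using w by (auto simp: bverts_def)
  qed
  let ?g = "inv_into (verts (fst x)) f"
  have g: "is_rooted_iso ?g y x" using is_rooted_iso_inv[OF f root] .
  have ry: "snd y \<in> verts (fst y)" using bij_betwE[OF b] root fr by metis
  show "bverts r y \<subseteq> f ` bverts r x"
  proof
    fix a assume "a \<in> bverts r y"
    then obtain k where a: "a \<in> verts (fst y)" "k \<le> r" "(adj (fst y) ^^ k) (snd y) a"
      by (auto simp: bverts_def)
    have "(adj (fst x) ^^ k) (snd x) (?g a)"
      using is_rooted_iso_relpow[OF g ry a(3)] g by (simp add: is_rooted_iso_def)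
    moreover have "?g a \<in> verts (fst x)"
      using g a(1) by (auto simp: is_rooted_iso_def bij_betw_def)
    ultimately have "?g a \<in> bverts r x" using a by (auto simp: bverts_def)
    moreover have "a = f (?g a)" using bij_betw_inv_into_right[OF b a(1)] by simp
    ultimately show "a \<in> f ` bverts r x" by blast
  qed
qed

lemma is_rooted_iso_rball:
  assumes f: "is_rooted_iso f x y" and root: "snd x \<in> verts (fst x)"
  shows "is_rooted_iso f (rball r x) (rball r y)"
proof -
  have img: "f ` bverts r x = bverts r y" using is_rooted_iso_bverts[OF assms] .
  moreover have "inj_on f (bverts r x)"
    using f inj_on_subset[OF _ bverts_subset] unfolding is_rooted_iso_def bij_betw_def by blast
  ultimately have "bij_betw f (bverts r x) (bverts r y)" by (simp add: bij_betw_def)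
  moreover have "adj (fst x) u v \<longleftrightarrow> adj (fst y) (f u) (f v)"
    if "u \<in> bverts r x" "v \<in> bverts r x" for u v
    using f that bverts_subset[of r x] by (auto simp: is_rooted_iso_def)
  ultimately show ?thesis
    using f img by (auto simp: is_rooted_iso_def)
qed

lemma rooted_iso_rball:
  "rooted_iso x y \<Longrightarrow> snd x \<in> verts (fst x) \<Longrightarrow> rooted_iso (rball r x) (rball r y)"
  unfolding rooted_iso_def using is_rooted_iso_rball by blast

lemma is_rooted_iso_rball_mono:
  assumes "is_rooted_iso f (rball s x) (rball s y)" "r \<le> s"
    and "snd x \<in> verts (fst x)" "snd y \<in> verts (fst y)"
  shows "is_rooted_iso f (rball r x) (rball r y)"
  using is_rooted_iso_rball[OF assms(1), of r] root_in_bverts[OF assms(3), of s]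
  by (simp add: rball_rball assms)

lemma rooted_iso_rball_mono:
  assumes "rooted_iso (rball s x) (rball s y)" "r \<le> s"
    and "snd x \<in> verts (fst x)" "snd y \<in> verts (fst y)"
  shows "rooted_iso (rball r x) (rball r y)"
  using assms is_rooted_iso_rball_mono unfolding rooted_iso_def by blast

lemma rooted_iso_rball_0:
  assumes "snd x \<in> verts (fst x)" "snd y \<in> verts (fst y)"
  shows "rooted_iso (rball 0 x) (rball 0 y)"
  unfolding rooted_iso_def is_rooted_iso_def
  by (rule exI[of _ "\<lambda>_. snd y"]) (auto simp: bverts_0 assms bij_betw_def)

lemma is_rooted_iso_cong:
  assumes "\<And>u. u \<in> verts (fst x) \<Longrightarrow> f u = g u" "snd x \<in> verts (fst x)"
  shows "is_rooted_iso f x y \<longleftrightarrow> is_rooted_iso g x y"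
  using assms bij_betw_cong[of "verts (fst x)" f g] by (auto simp: is_rooted_iso_def)

lemma finite_bverts:
  assumes "loc_finite (fst x)"
  shows "finite (bverts r x)"
proof -
  have "finite {w \<in> verts (fst x). (adj (fst x) ^^ k) (snd x) w}" for k
  proof (induction k)
    case 0
    show ?case by (rule finite_subset[of _ "{snd x}"]) auto
  next
    case (Suc k)
    let ?A = "{w \<in> verts (fst x). (adj (fst x) ^^ k) (snd x) w}"
    have "{w \<in> verts (fst x). (adj (fst x) ^^ Suc k) (snd x) w} \<subseteq> (\<Union>z\<in>?A. nbrs (fst x) z)"
      by (auto simp: relcompp_apply nbrs_def dest: adj_verts)
    moreover have "finite (\<Union>z\<in>?A. nbrs (fst x) z)"
      using Suc assms by (auto simp: loc_finite_def)
    ultimately show ?case by (rule finite_subset)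
  qed
  moreover have "bverts r x = (\<Union>k\<in>{..r}. {w \<in> verts (fst x). (adj (fst x) ^^ k) (snd x) w})"
    by (auto simp: bverts_def)
  ultimately show ?thesis by auto
qed

lemma clf_verts_UN:
  assumes "clf_rgraph x"
  shows "verts (fst x) = (\<Union>r. bverts r x)"
proof -
  have "\<exists>r. w \<in> bverts r x" if "w \<in> verts (fst x)" for w
  proof -
    have "(adj (fst x))\<^sup>*\<^sup>* (snd x) w"
      using assms that by (auto simp: clf_rgraph_def graph_connected_def)
    then obtain k where "(adj (fst x) ^^ k) (snd x) w" by (auto simp: rtranclp_power)
    then show ?thesis using that by (auto simp: bverts_def)
  qed
  then show ?thesis using bverts_subset by fast
qed

lemma clf_countable:
  assumes "clf_rgraph x"
  shows "countable (verts (fst x))"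
proof -
  have "finite (bverts r x)" for r
    using assms by (intro finite_bverts) (simp add: clf_rgraph_def)
  then have "countable (bverts r x)" for r by (rule countable_finite)
  then show ?thesis
    unfolding clf_verts_UN[OF assms] by simp
qed

lemma clf_rgraph_iso:
  assumes "clf_rgraph x" "rooted_iso x y"
  shows "clf_rgraph y"
proof -
  obtain f where f: "is_rooted_iso f x y" using assms by (auto simp: rooted_iso_def)
  have b: "f ` verts (fst x) = verts (fst y)" and fr: "f (snd x) = snd y"
    and a: "\<And>u v. u \<in> verts (fst x) \<Longrightarrow> v \<in> verts (fst x) \<Longrightarrow>
       adj (fst x) u v \<longleftrightarrow> adj (fst y) (f u) (f v)"
    using f by (auto simp: is_rooted_iso_def bij_betw_def)
  have 1: "snd y \<in> verts (fst y)" using assms b fr by (force simp: clf_rgraph_def)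
  have "(adj (fst y))\<^sup>*\<^sup>* (f u) (f v)" if "u \<in> verts (fst x)" "v \<in> verts (fst x)" for u v
  proof -
    have "(adj (fst x))\<^sup>*\<^sup>* u v"
      using that assms by (auto simp: clf_rgraph_def graph_connected_def)
    then show ?thesis
      using is_rooted_iso_relpow[OF f that(1)] by (meson rtranclp_power)
  qed
  then have 2: "graph_connected (fst y)"
    using 1 unfolding graph_connected_def b[symmetric] by auto
  have "finite (nbrs (fst y) (f u))" if "u \<in> verts (fst x)" for u
  proof -
    have "nbrs (fst y) (f u) \<subseteq> f ` nbrs (fst x) u"
      using a[OF that] adj_verts unfolding nbrs_def by (fastforce simp flip: b)
    moreover have "finite (f ` nbrs (fst x) u)"
      using that assms by (auto simp: clf_rgraph_def loc_finite_def)
    ultimately show ?thesis by (rule finite_subset)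
  qed
  then have 3: "loc_finite (fst y)" unfolding loc_finite_def b[symmetric] by auto
  show ?thesis using 1 2 3 by (auto simp: clf_rgraph_def)
qed

lemma clf_nat_representative:
  assumes "clf_rgraph x"
  shows "\<exists>y :: nat rgraph. clf_rgraph y \<and> rooted_iso x y"
proof -
  let ?f = "to_nat_on (verts (fst x))"
  let ?y = "(image_graph ?f (fst x), ?f (snd x))"
  have inj: "inj_on ?f (verts (fst x))"
    using clf_countable[OF assms] by (rule inj_on_to_nat_on)
  have "is_rooted_iso ?f x ?y"
    using inj by (auto simp: is_rooted_iso_def bij_betw_def adj_image_graph)
  then have "rooted_iso x ?y" by (auto simp: rooted_iso_def)
  with clf_rgraph_iso[OF assms] show ?thesis by blast
qed

text \<open>A Koenig-type compactness argument: isomorphic balls of every radius force isomorphism.\<close>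

lemma rooted_iso_if_all_balls:
  fixes x :: "'a rgraph" and y :: "'b rgraph"
  assumes x: "clf_rgraph x" and y: "clf_rgraph y"
    and balls: "\<And>r. rooted_iso (rball r x) (rball r y)"
  shows "rooted_iso x y"
proof -
  have rx: "snd x \<in> verts (fst x)" and ry: "snd y \<in> verts (fst y)"
    using x y by (auto simp: clf_rgraph_def)
  define S where "S r = {f \<in> extensional (bverts r x). is_rooted_iso f (rball r x) (rball r y)}" for r
  have S_restrict: "restrict f (bverts r x) \<in> S r"
    if "is_rooted_iso f (rball s x) (rball s y)" "r \<le> s" for f r s
    using is_rooted_iso_rball_mono[OF that rx ry]
      is_rooted_iso_cong[of "rball r x" f "restrict f (bverts r x)" "rball r y"] rx
    by (auto simp: S_def root_in_bverts)
  have S_ne: "S r \<noteq> {}" for r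
    using balls[of r] S_restrict[of _ r r] by (auto simp: rooted_iso_def)
  have S_fin: "finite (S r)" for r
  proof (rule finite_subset)
    show "S r \<subseteq> bverts r x \<rightarrow>\<^sub>E bverts r y"
      by (auto simp: S_def is_rooted_iso_def bij_betw_def PiE_def)
    show "finite (bverts r x \<rightarrow>\<^sub>E bverts r y)"
      using x y by (intro finite_PiE finite_bverts) (auto simp: clf_rgraph_def)
  qed
  define good where
    "good r f \<longleftrightarrow> f \<in> S r \<and> (\<forall>R\<ge>r. \<exists>g\<in>S R. restrict g (bverts r x) = f)" for r f
  have S0: "f = (\<lambda>_\<in>{snd x}. snd y)" if "is_rooted_iso g (rball R x) (rball R y)"
    "f = restrict g (bverts 0 x)" for f g R
    using that by (auto simp: bverts_0 rx is_rooted_iso_def fun_eq_iff)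
  have good0: "good 0 (\<lambda>_\<in>{snd x}. snd y)"
  proof -
    have *: "\<exists>g\<in>S R. restrict g (bverts 0 x) = (\<lambda>_\<in>{snd x}. snd y)" for R
      using S_ne[of R] S0[of _ R] by (auto simp: S_def)
    then show ?thesis
      using S_restrict[of _ 0 0] unfolding good_def S_def by fastforce
  qed
  have good_step: "\<exists>f'. good (Suc r) f' \<and> restrict f' (bverts r x) = f" if g: "good r f" for r f
  proof (rule ccontr)
    assume no: "\<nexists>f'. good (Suc r) f' \<and> restrict f' (bverts r x) = f"
    have "\<exists>N\<ge>Suc r. \<forall>g\<in>S N. restrict g (bverts (Suc r) x) \<noteq> f'"
      if "f' \<in> S (Suc r)" "restrict f' (bverts r x) = f" for f'
      using no that unfolding good_def by blast
    then obtain N where N: "\<And>f'. f' \<in> S (Suc r) \<Longrightarrow> restrict f' (bverts r x) = f \<Longrightarrow>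
        N f' \<ge> Suc r \<and> (\<forall>g\<in>S (N f'). restrict g (bverts (Suc r) x) \<noteq> f')"
      by metis
    define M where "M = Max (insert (Suc r) (N ` S (Suc r)))"
    have M: "M \<ge> Suc r" "\<And>f'. f' \<in> S (Suc r) \<Longrightarrow> N f' \<le> M"
      unfolding M_def using S_fin by auto
    obtain h where h: "h \<in> S M" "restrict h (bverts r x) = f"
      using g M(1) unfolding good_def by (meson Suc_leD)
    have hi: "is_rooted_iso h (rball M x) (rball M y)" using h by (auto simp: S_def)
    define f' where "f' = restrict h (bverts (Suc r) x)"
    have f': "f' \<in> S (Suc r)" unfolding f'_def using S_restrict[OF hi M(1)] .
    have "restrict f' (bverts r x) = f"
      unfolding f'_def h(2)[symmetric] using bverts_mono[of r "Suc r" x]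
      by (auto simp: restrict_def fun_eq_iff)
    note N' = N[OF f' this]
    have "restrict h (bverts (N f') x) \<in> S (N f')" using S_restrict[OF hi M(2)[OF f']] .
    moreover have "restrict (restrict h (bverts (N f') x)) (bverts (Suc r) x) = f'"
      unfolding f'_def using bverts_mono[of "Suc r" "N f'" x] N'
      by (auto simp: restrict_def fun_eq_iff f'_def)
    ultimately show False using N' by blast
  qed
  obtain F where F: "\<And>r. good r (F r)" "\<And>r. restrict (F (Suc r)) (bverts r x) = F r"
    using dependent_nat_choice[of good "\<lambda>r f f'. restrict f' (bverts r x) = f"] good0 good_step
    by metis
  have Fmono: "F s u = F r u" if "r \<le> s" "u \<in> bverts r x" for r s u
    using that
  proof (induction s rule: dec_induct)
    case (step n)
    have "u \<in> bverts n x" using step bverts_mono[of r n x] by auto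
    then have "F (Suc n) u = F n u" using F(2)[of n] by (metis restrict_apply')
    with step show ?case by simp
  qed simp
  define f where "f u = F (LEAST r. u \<in> bverts r x) u" for u
  have f: "f u = F r u" if "u \<in> bverts r x" for r u
    unfolding f_def using Fmono[OF Least_le[of "\<lambda>r. u \<in> bverts r x", OF that] LeastI[of "\<lambda>r. u \<in> bverts r x", OF that]]
    by simp
  have Fi: "is_rooted_iso (F r) (rball r x) (rball r y)" for r
    using F(1)[of r] by (auto simp: good_def S_def)
  have fi: "is_rooted_iso f (rball r x) (rball r y)" for r
    using Fi[of r] is_rooted_iso_cong[of "rball r x" f "F r" "rball r y"] f rx
    by (auto simp: root_in_bverts)
  have common: "\<exists>r. u \<in> bverts r x \<and> v \<in> bverts r x"
    if uv: "u \<in> verts (fst x)" "v \<in> verts (fst x)" for u v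
  proof -
    obtain r s where "u \<in> bverts r x" "v \<in> bverts s x"
      using clf_verts_UN[OF x] uv by auto
    then have "u \<in> bverts (max r s) x" "v \<in> bverts (max r s) x"
      using bverts_mono[of r "max r s" x] bverts_mono[of s "max r s" x] by auto
    then show ?thesis by blast
  qed
  have "is_rooted_iso f x y"
    unfolding is_rooted_iso_def
  proof (intro conjI ballI)
    have img: "f ` bverts r x = bverts r y" and inj: "inj_on f (bverts r x)" for r
      using fi[of r] by (auto simp: is_rooted_iso_def bij_betw_def)
    have "f ` verts (fst x) = verts (fst y)"
      by (simp add: clf_verts_UN[OF x] clf_verts_UN[OF y] image_UN img)
    moreover have "inj_on f (verts (fst x))"
      by (intro inj_onI) (metis common inj inj_onD)
    ultimately show "bij_betw f (verts (fst x)) (verts (fst y))" by (simp add: bij_betw_def)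
    show "f (snd x) = snd y" using fi[of 0] by (simp add: is_rooted_iso_def)
    fix u v assume "u \<in> verts (fst x)" "v \<in> verts (fst x)"
    then obtain r where r: "u \<in> bverts r x" "v \<in> bverts r x" using common by blast
    then have "f u \<in> bverts r y" "f v \<in> bverts r y" using img by auto
    with r fi[of r] show "adj (fst x) u v \<longleftrightarrow> adj (fst y) (f u) (f v)"
      by (auto simp: is_rooted_iso_def)
  qed
  then show ?thesis by (auto simp: rooted_iso_def)
qed

lemma is_rooted_iso_nbrs:
  assumes f: "is_rooted_iso f x y" and u: "u \<in> verts (fst x)"
  shows "bij_betw f (nbrs (fst x) u) (nbrs (fst y) (f u))"
  unfolding bij_betw_def
proof
  have b: "inj_on f (verts (fst x))" "f ` verts (fst x) = verts (fst y)"
    using f by (auto simp: is_rooted_iso_def bij_betw_def)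
  have sub: "nbrs (fst x) u \<subseteq> verts (fst x)" by (auto simp: nbrs_def dest: adj_verts)
  show "inj_on f (nbrs (fst x) u)" using b(1) sub by (rule inj_on_subset)
  show "f ` nbrs (fst x) u = nbrs (fst y) (f u)"
  proof (intro equalityI subsetI)
    fix a assume "a \<in> f ` nbrs (fst x) u"
    then show "a \<in> nbrs (fst y) (f u)"
      using f u sub by (auto simp: is_rooted_iso_def nbrs_def dest: adj_verts)
  next
    fix a assume a: "a \<in> nbrs (fst y) (f u)"
    then have "a \<in> verts (fst y)" by (auto simp: nbrs_def dest: adj_verts)
    then obtain w where "w \<in> verts (fst x)" "a = f w" using b by auto
    with a show "a \<in> f ` nbrs (fst x) u"
      using f u by (auto simp: is_rooted_iso_def nbrs_def)
  qed
qed

lemma vdeg_rooted_iso: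
  assumes "rooted_iso x y" "snd x \<in> verts (fst x)"
  shows "vdeg (fst x) (snd x) = vdeg (fst y) (snd y)"
proof -
  obtain f where f: "is_rooted_iso f x y" using assms by (auto simp: rooted_iso_def)
  then have "f (snd x) = snd y" by (simp add: is_rooted_iso_def)
  with bij_betw_same_card[OF is_rooted_iso_nbrs[OF f assms(2)]] show ?thesis
    by (simp add: vdeg_def)
qed

lemma rooted_emb_push:
  assumes f: "is_rooted_iso f x y" and e: "e \<in> embeddings H (fst x)" "e v = snd x"
    and v: "v \<in> verts H"
  shows "restrict (f \<circ> e) (verts H) \<in> {e \<in> embeddings H (fst y). e v = snd y}"
proof -
  have m: "\<And>u. u \<in> verts H \<Longrightarrow> e u \<in> verts (fst x)"
    and ie: "inj_on e (verts H)"
    and ae: "\<And>u v. adj H u v \<Longrightarrow> adj (fst x) (e u) (e v)"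
    using e by (auto simp: embeddings_def)
  have fi: "inj_on f (verts (fst x))" and fv: "\<And>u. u \<in> verts (fst x) \<Longrightarrow> f u \<in> verts (fst y)"
    and fr: "f (snd x) = snd y"
    using f by (auto simp: is_rooted_iso_def bij_betw_def)
  have "inj_on (restrict (f \<circ> e) (verts H)) (verts H)"
  proof (rule inj_onI)
    fix a b assume ab: "a \<in> verts H" "b \<in> verts H"
      and eq: "restrict (f \<circ> e) (verts H) a = restrict (f \<circ> e) (verts H) b"
    then have "e a = e b" using inj_onD[OF fi] m by simp
    then show "a = b" using inj_onD[OF ie] ab by blast
  qed
  moreover have "adj (fst y) (restrict (f \<circ> e) (verts H) u) (restrict (f \<circ> e) (verts H) w)"
    if "adj H u w" for u w
    using ae[OF that] m adj_verts[OF that] f by (simp add: is_rooted_iso_def)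
  ultimately show ?thesis
    using e(2) fr v m fv by (auto simp: embeddings_def)
qed

lemma bij_betw_rooted_emb:
  assumes f: "is_rooted_iso f x y" and rx: "snd x \<in> verts (fst x)" and v: "v \<in> verts H"
  shows "bij_betw (\<lambda>e. restrict (f \<circ> e) (verts H))
    {e \<in> embeddings H (fst x). e v = snd x} {e \<in> embeddings H (fst y). e v = snd y}"
proof -
  let ?g = "inv_into (verts (fst x)) f"
  have g: "is_rooted_iso ?g y x" using is_rooted_iso_inv[OF f rx] .
  have b: "bij_betw f (verts (fst x)) (verts (fst y))" using f by (auto simp: is_rooted_iso_def)
  show ?thesis
  proof (rule bij_betw_byWitness[where f' = "\<lambda>e. restrict (?g \<circ> e) (verts H)"]; intro ballI subsetI)
    fix e assume "e \<in> {e \<in> embeddings H (fst x). e v = snd x}"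
    then have e: "e \<in> verts H \<rightarrow>\<^sub>E verts (fst x)" by (simp add: embeddings_def)
    show "restrict (?g \<circ> restrict (f \<circ> e) (verts H)) (verts H) = e"
    proof
      fix u show "restrict (?g \<circ> restrict (f \<circ> e) (verts H)) (verts H) u = e u"
        using bij_betw_inv_into_left[OF b, of "e u"] PiE_mem[OF e, of u] PiE_arb[OF e, of u]
        by (cases "u \<in> verts H") auto
    qed
  next
    fix e assume "e \<in> {e \<in> embeddings H (fst y). e v = snd y}"
    then have e: "e \<in> verts H \<rightarrow>\<^sub>E verts (fst y)" by (simp add: embeddings_def)
    show "restrict (f \<circ> restrict (?g \<circ> e) (verts H)) (verts H) = e"
    proof
      fix u show "restrict (f \<circ> restrict (?g \<circ> e) (verts H)) (verts H) u = e u"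
        using bij_betw_inv_into_right[OF b, of "e u"] PiE_mem[OF e, of u] PiE_arb[OF e, of u]
        by (cases "u \<in> verts H") auto
    qed
  next
    fix a assume "a \<in> (\<lambda>e. restrict (f \<circ> e) (verts H)) ` {e \<in> embeddings H (fst x). e v = snd x}"
    then show "a \<in> {e \<in> embeddings H (fst y). e v = snd y}"
      using rooted_emb_push[OF f _ _ v] by blast
  next
    fix a assume "a \<in> (\<lambda>e. restrict (?g \<circ> e) (verts H)) ` {e \<in> embeddings H (fst y). e v = snd y}"
    then show "a \<in> {e \<in> embeddings H (fst x). e v = snd x}"
      using rooted_emb_push[OF g _ _ v] by blast
  qed
qed

lemma rooted_emb_rooted_iso:
  assumes "rooted_iso x y" "snd x \<in> verts (fst x)" "snd H' \<in> verts (fst H')"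
  shows "rooted_emb H' (fst x) (snd x) = rooted_emb H' (fst y) (snd y)"
  using assms bij_betw_same_card[OF bij_betw_rooted_emb[OF _ assms(2,3)]]
  unfolding rooted_iso_def rooted_emb_def by blast

lemma clf_component:
  assumes "finite (verts G)" "v \<in> verts G"
  shows "clf_rgraph (component G v, v)"
proof -
  let ?C = "component G v"
  have reach: "(adj ?C)\<^sup>*\<^sup>* v w" if "(adj G)\<^sup>*\<^sup>* v w" for w
    using that
  proof induction
    case (step y z)
    then have "(adj G)\<^sup>*\<^sup>* v z" by (simp add: rtranclp.rtrancl_into_rtrancl)
    with step have "adj ?C y z"
      using adj_verts[OF step(2)] by (simp add: component_def)
    with step.IH show ?case by (rule rtranclp.rtrancl_into_rtrancl)
  qed simp
  have "symp (adj ?C)" by (auto intro!: sympI dest: adj_sym)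
  then have sym: "(adj ?C)\<^sup>*\<^sup>* u w \<Longrightarrow> (adj ?C)\<^sup>*\<^sup>* w u" for u w
    by (meson sympD symp_rtranclp)
  have "verts ?C \<subseteq> verts G" by (auto simp: component_def)
  then have "finite (verts ?C)" using assms finite_subset by blast
  moreover have "nbrs ?C u \<subseteq> verts ?C" for u by (auto simp: nbrs_def dest: adj_verts)
  ultimately have "loc_finite ?C" by (auto simp: loc_finite_def intro: finite_subset)
  moreover have "v \<in> verts ?C" using assms by (simp add: component_def)
  moreover have "(adj ?C)\<^sup>*\<^sup>* u w" if "u \<in> verts ?C" "w \<in> verts ?C" for u w
    using that sym[OF reach[of u]] reach[of w] by (auto simp: component_def)
  ultimately show ?thesis
    by (auto simp: clf_rgraph_def graph_connected_def)
qed


section \<open>The space of rooted graphs\<close>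

text \<open>A connected locally finite graph is countable, so representatives with vertices in
  \<^typ>\<open>nat\<close> suffice; see \<open>clf_nat_representative\<close>.\<close>

quotient_type gstar = "nat rgraph" /
  partial: "\<lambda>x y. clf_rgraph x \<and> clf_rgraph y \<and> rooted_iso x y"
proof (rule part_equivpI)
  have "clf_rgraph (edgeless {0 :: nat}, 0)"
    by (auto simp: clf_rgraph_def graph_connected_def loc_finite_def nbrs_def)
  then show "\<exists>x :: nat rgraph. clf_rgraph x \<and> clf_rgraph x \<and> rooted_iso x x"
    using rooted_iso_refl by blast
  show "symp (\<lambda>x y :: nat rgraph. clf_rgraph x \<and> clf_rgraph y \<and> rooted_iso x y)"
    by (auto intro!: sympI rooted_iso_sym simp: clf_rgraph_def)
  show "transp (\<lambda>x y :: nat rgraph. clf_rgraph x \<and> clf_rgraph y \<and> rooted_iso x y)"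
    by (auto intro!: transpI intro: rooted_iso_trans)
qed

text \<open>The isomorphism class of a connected locally finite rooted graph on any vertex type;
  unspecified for other rooted graphs.\<close>

definition gstar_of :: "'a rgraph \<Rightarrow> gstar" where
  "gstar_of x = abs_gstar (SOME y. clf_rgraph y \<and> rooted_iso x y)"

definition root_deg :: "gstar \<Rightarrow> nat" where
  "root_deg X = vdeg (fst (rep_gstar X)) (snd (rep_gstar X))"

text \<open>The values of \<open>root_deg\<close> and, provided that the root of \<open>H'\<close> is a vertex of \<open>H'\<close>, of
  \<open>root_emb\<close> do not depend on the representative; see \<open>root_deg_gstar_of\<close> and
  \<open>root_emb_gstar_of\<close>.\<close>

definition root_emb :: "'a rgraph \<Rightarrow> gstar \<Rightarrow> nat" where
  "root_emb H' X = rooted_emb H' (fst (rep_gstar X)) (snd (rep_gstar X))"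

lemma clf_rep_gstar: "clf_rgraph (rep_gstar X)"
  using Quotient_rep_reflp[OF Quotient_gstar] by auto

lemma abs_gstar_eq_iff:
  "clf_rgraph x \<Longrightarrow> clf_rgraph y \<Longrightarrow> abs_gstar x = abs_gstar y \<longleftrightarrow> rooted_iso x y"
  using Quotient_rel[OF Quotient_gstar, of x y] rooted_iso_refl by blast

lemma rooted_iso_rep_gstar_of:
  assumes "clf_rgraph x"
  shows "rooted_iso x (rep_gstar (gstar_of x))"
proof -
  define y where "y = (SOME y :: nat rgraph. clf_rgraph y \<and> rooted_iso x y)"
  have y: "clf_rgraph y" "rooted_iso x y"
    unfolding y_def using someI_ex[OF clf_nat_representative[OF assms]] by auto
  have "abs_gstar (rep_gstar (abs_gstar y)) = abs_gstar y"
    by (rule Quotient_abs_rep[OF Quotient_gstar])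
  then have "rooted_iso y (rep_gstar (abs_gstar y))"
    using abs_gstar_eq_iff[OF y(1) clf_rep_gstar] by metis
  then have "rooted_iso x (rep_gstar (abs_gstar y))"
    using y(2) rooted_iso_trans by blast
  then show ?thesis by (simp add: gstar_of_def y_def)
qed

lemma root_deg_gstar_of:
  "clf_rgraph x \<Longrightarrow> root_deg (gstar_of x) = vdeg (fst x) (snd x)"
  unfolding root_deg_def
  by (rule vdeg_rooted_iso[OF rooted_iso_rep_gstar_of, symmetric]) (simp_all add: clf_rgraph_def)

lemma root_emb_gstar_of:
  "clf_rgraph x \<Longrightarrow> snd H' \<in> verts (fst H') \<Longrightarrow>
    root_emb H' (gstar_of x) = rooted_emb H' (fst x) (snd x)"
  unfolding root_emb_def
  by (rule rooted_emb_rooted_iso[OF rooted_iso_rep_gstar_of, symmetric]) (simp_all add: clf_rgraph_def)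


subsection \<open>The metric\<close>

lemma dloc_cases: "dloc x y = 0 \<or> (\<exists>n. dloc x y = 1 / 2 ^ n)"
  by (auto simp: dloc_def split: enat.split)

lemma dloc_nonneg: "dloc x y \<ge> 0"
  using dloc_cases[of x y] by auto

lemma dloc_le_iff:
  assumes "clf_rgraph x" "clf_rgraph y"
  shows "dloc x y \<le> 1 / 2 ^ r \<longleftrightarrow> rooted_iso (rball r x) (rball r y)"
proof -
  define R where "R = {r. rooted_iso (rball r x) (rball r y)}"
  have rx: "snd x \<in> verts (fst x)" and ry: "snd y \<in> verts (fst y)"
    using assms by (auto simp: clf_rgraph_def)
  have d: "dloc x y = (case (SUP r\<in>R. enat r) of enat r \<Rightarrow> 1 / 2 ^ r | \<infinity> \<Rightarrow> 0)"
    by (simp add: dloc_def R_def)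
  show ?thesis
  proof
    assume "rooted_iso (rball r x) (rball r y)"
    then have "enat r \<le> (SUP r\<in>R. enat r)" by (intro SUP_upper) (simp add: R_def)
    then show "dloc x y \<le> 1 / 2 ^ r"
      unfolding d by (cases "SUP r\<in>R. enat r") (auto simp: field_simps)
  next
    assume le: "dloc x y \<le> 1 / 2 ^ r"
    show "rooted_iso (rball r x) (rball r y)"
    proof (rule ccontr)
      assume no: "\<not> rooted_iso (rball r x) (rball r y)"
      then have "r \<noteq> 0" using rooted_iso_rball_0[OF rx ry] by metis
      have "s \<le> r - 1" if "s \<in> R" for s
      proof (rule ccontr)
        assume "\<not> s \<le> r - 1"
        then have "r \<le> s" using \<open>r \<noteq> 0\<close> by simp
        with that no show False
          using rooted_iso_rball_mono[OF _ _ rx ry] by (auto simp: R_def)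
      qed
      then have "(SUP r\<in>R. enat r) \<le> enat (r - 1)" by (intro SUP_least) simp
      then obtain n where n: "(SUP r\<in>R. enat r) = enat n" "n \<le> r - 1"
        by (cases "SUP r\<in>R. enat r") auto
      then have "(2::real) ^ n < 2 ^ r" using \<open>r \<noteq> 0\<close> by (intro power_strict_increasing) auto
      then show False using le n unfolding d by (simp add: field_simps)
    qed
  qed
qed

lemma dloc_le_0I:
  assumes "\<And>r. dloc x y \<le> 1 / 2 ^ r"
  shows "dloc x y = 0"
proof (rule ccontr)
  assume "dloc x y \<noteq> 0"
  then obtain n where n: "dloc x y = 1 / 2 ^ n" using dloc_cases by blast
  show False using assms[of "Suc n"] n by (simp add: field_simps)
qed

lemma dloc_eq_0_iff:
  assumes "clf_rgraph x" "clf_rgraph y"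
  shows "dloc x y = 0 \<longleftrightarrow> rooted_iso x y"
proof
  assume "dloc x y = 0"
  then have "rooted_iso (rball r x) (rball r y)" for r
    using dloc_le_iff[OF assms, of r] by simp
  then show "rooted_iso x y" using rooted_iso_if_all_balls[OF assms] by blast
next
  assume "rooted_iso x y"
  then have "dloc x y \<le> 1 / 2 ^ r" for r
    using rooted_iso_rball[of x y r] assms by (simp add: dloc_le_iff) (simp add: clf_rgraph_def)
  then show "dloc x y = 0" by (rule dloc_le_0I)
qed

lemma dloc_ultrametric:
  assumes "clf_rgraph x" "clf_rgraph y" "clf_rgraph z"
  shows "dloc x z \<le> max (dloc x y) (dloc y z)"
proof -
  have *: "dloc x z \<le> 1 / 2 ^ r" if "dloc x y \<le> 1 / 2 ^ r" "dloc y z \<le> 1 / 2 ^ r" for r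
    using that rooted_iso_trans by (simp add: dloc_le_iff assms) blast
  consider "max (dloc x y) (dloc y z) = 0" | n where "max (dloc x y) (dloc y z) = 1 / 2 ^ n"
    using dloc_cases[of x y] dloc_cases[of y z] by (metis max_def)
  then show ?thesis
  proof cases
    case 1
    then have "dloc x y \<le> 0" "dloc y z \<le> 0" by (metis max.cobounded1 max.cobounded2)+
    then have "dloc x z \<le> 1 / 2 ^ r" for r
      using *[of r] by (smt (verit) zero_le_divide_1_iff zero_le_power)
    then show ?thesis using dloc_le_0I[of x z] 1 by simp
  next
    case 2
    then show ?thesis using *[of n] by (metis max.cobounded1 max.cobounded2)
  qed
qed

lemma dloc_sym:
  assumes "clf_rgraph x" "clf_rgraph y"
  shows "dloc x y = dloc y x"
proof -
  have "rooted_iso (rball r x) (rball r y) \<longleftrightarrow> rooted_iso (rball r y) (rball r x)" for r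
    using assms rooted_iso_sym[of "rball r x" "rball r y"] rooted_iso_sym[of "rball r y" "rball r x"]
    by (auto simp: clf_rgraph_def root_in_bverts)
  then show ?thesis by (simp add: dloc_def)
qed

instantiation gstar :: metric_space
begin

definition dist_gstar :: "gstar \<Rightarrow> gstar \<Rightarrow> real" where
  "dist X Y = dloc (rep_gstar X) (rep_gstar Y)"

definition uniformity_gstar :: "(gstar \<times> gstar) filter" where
  "uniformity = (INF e\<in>{0<..}. principal {(X :: gstar, Y). dist X Y < e})"

definition open_gstar :: "gstar set \<Rightarrow> bool" where
  "open (U :: gstar set) \<longleftrightarrow> (\<forall>X\<in>U. eventually (\<lambda>(X', Y). X' = X \<longrightarrow> Y \<in> U) uniformity)"

instance
proof
  fix X Y Z :: gstar
  show "dist X Y = 0 \<longleftrightarrow> X = Y"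
  proof -
    have "rooted_iso (rep_gstar X) (rep_gstar Y) \<longleftrightarrow> X = Y"
      using abs_gstar_eq_iff[OF clf_rep_gstar clf_rep_gstar, of X Y]
      by (simp add: Quotient_abs_rep[OF Quotient_gstar])
    then show ?thesis by (simp add: dist_gstar_def dloc_eq_0_iff clf_rep_gstar)
  qed
  show "dist X Y \<le> dist X Z + dist Y Z"
    using dloc_ultrametric[OF clf_rep_gstar[of X] clf_rep_gstar[of Z] clf_rep_gstar[of Y]]
      dloc_sym[OF clf_rep_gstar[of Y] clf_rep_gstar[of Z]]
      dloc_nonneg[of "rep_gstar X" "rep_gstar Z"] dloc_nonneg[of "rep_gstar Y" "rep_gstar Z"]
    unfolding dist_gstar_def by linarith
qed (simp_all add: uniformity_gstar_def open_gstar_def)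

end

lemma dist_gstar_of:
  assumes "clf_rgraph x" "clf_rgraph y"
  shows "dist (gstar_of x) (gstar_of y) = dloc x y"
proof -
  let ?x = "rep_gstar (gstar_of x)" and ?y = "rep_gstar (gstar_of y)"
  have "rooted_iso (rball r ?x) (rball r ?y) \<longleftrightarrow> rooted_iso (rball r x) (rball r y)" for r
  proof -
    have r: "snd x \<in> verts (fst x)" "snd y \<in> verts (fst y)"
      using assms by (auto simp: clf_rgraph_def)
    have i: "rooted_iso (rball r x) (rball r ?x)" "rooted_iso (rball r y) (rball r ?y)"
      using r assms by (auto intro!: rooted_iso_rball rooted_iso_rep_gstar_of)
    have j: "rooted_iso (rball r ?x) (rball r x)" "rooted_iso (rball r ?y) (rball r y)"
      using i r by (auto intro!: rooted_iso_sym simp: root_in_bverts)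
    show ?thesis
    proof
      assume "rooted_iso (rball r ?x) (rball r ?y)"
      from rooted_iso_trans[OF rooted_iso_trans[OF i(1) this] j(2)]
      show "rooted_iso (rball r x) (rball r y)" .
    next
      assume "rooted_iso (rball r x) (rball r y)"
      from rooted_iso_trans[OF rooted_iso_trans[OF j(1) this] i(2)]
      show "rooted_iso (rball r ?x) (rball r ?y)" .
    qed
  qed
  then show ?thesis by (simp add: dist_gstar_def dloc_def)
qed


section \<open>Local weak convergence and uniform integrability\<close>

definition unif_vertex :: "'a ugraph \<Rightarrow> 'a measure" where
  "unif_vertex G = measure_pmf (pmf_of_set (verts G))"

definition local_law :: "'a ugraph \<Rightarrow> gstar measure" where
  "local_law G = distr (unif_vertex G) borel (\<lambda>v. gstar_of (component G v, v))"

definition weakly_converges ::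
    "(nat \<Rightarrow> 'a :: topological_space measure) \<Rightarrow> 'a measure \<Rightarrow> bool" where
  "weakly_converges \<mu> \<nu> \<longleftrightarrow> (\<forall>f :: 'a \<Rightarrow> real. continuous_on UNIV f \<and> bounded (range f) \<longrightarrow>
     (\<lambda>n. \<integral>x. f x \<partial>\<mu> n) \<longlonglongrightarrow> (\<integral>x. f x \<partial>\<nu>))"

text \<open>The random variables \<open>X n\<close> may live on different probability spaces \<open>M n\<close>. Values are in
  \<^typ>\<open>ennreal\<close>, so non-integrable tails count as \<open>\<infinity>\<close>.\<close>

definition uniformly_integrable :: "(nat \<Rightarrow> 'a measure) \<Rightarrow> (nat \<Rightarrow> 'a \<Rightarrow> real) \<Rightarrow> bool" where
  "uniformly_integrable M X \<longleftrightarrow> (\<forall>n. X n \<in> borel_measurable (M n)) \<and>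
     ((\<lambda>K :: real. SUP n. \<integral>\<^sup>+ \<omega>. ennreal \<bar>X n \<omega>\<bar> * indicator {\<omega>. \<bar>X n \<omega>\<bar> > K} \<omega> \<partial>M n)
        \<longlongrightarrow> 0) at_top"

end

theory Submission
  imports Defs
begin

text \<open>Conditions (i) and (ii) are both equivalent to the tails
  \<open>\<bbbE> d\<^sub>n ^ (h - 1) \<cdot> 1{d\<^sub>n > K}\<close> being small uniformly in \<open>n\<close> for large \<open>K\<close>, because truncated functions
  of the degree are bounded and continuous in the local topology. Embeddings of a connected graph on
  \<open>h\<close> vertices whose image has all degrees at most \<open>K\<close> are also counted by a bounded local function,
  while those meeting a vertex of larger degree number at most \<open>h\<close> times the sum of
  \<open>d(w) ^ (h - 1)\<close> over the vertices \<open>w\<close> with \<open>d(w) > K\<close>: root the embedding at its vertex of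
  maximal degree. So small tails imply (iii). Conversely, the star rooted at its centre turns (iii)
  into the convergence of the mean of the falling factorial of \<open>d\<^sub>n\<close>, which for large degrees is
  comparable to \<open>d\<^sub>n ^ (h - 1)\<close>.\<close>

section \<open>Embeddings of bounded degree\<close>

text \<open>The degree bound is imposed at every image vertex, not only at the root: this makes the
  count at \<open>v\<close> bounded in terms of \<open>K\<close> and \<open>H'\<close>, while it
  still depends only on a ball around \<open>v\<close>.\<close>

definition bounded_embs :: "nat \<Rightarrow> 'a rgraph \<Rightarrow> 'b ugraph \<Rightarrow> 'b \<Rightarrow> ('a \<Rightarrow> 'b) set" where
  "bounded_embs K H' G v = {f \<in> embeddings (fst H') G. f (snd H') = v \<and>
     (\<forall>u\<in>verts (fst H'). vdeg G (f u) \<le> K)}"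

definition bounded_emb :: "nat \<Rightarrow> 'a rgraph \<Rightarrow> 'b ugraph \<Rightarrow> 'b \<Rightarrow> nat" where
  "bounded_emb K H' G v = card (bounded_embs K H' G v)"

lemma finite_verts_loc_finite: "finite (verts G) \<Longrightarrow> loc_finite G"
  unfolding loc_finite_def nbrs_def by (auto intro: finite_subset[of _ "verts G"] dest: adj_verts)

lemma nbrs_subset_verts: "nbrs G v \<subseteq> verts G"
  by (auto simp: nbrs_def dest: adj_verts)

section \<open>Locality of bounded embedding counts\<close>

lemma embedding_relpow:
  assumes "f \<in> embeddings H G" "(adj H ^^ k) u w"
  shows "(adj G ^^ k) (f u) (f w)"
  using assms(2)
proof (induction k arbitrary: w)
  case (Suc k)
  then obtain z where "(adj H ^^ k) u z" "adj H z w" by auto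
  with Suc.IH[of z] assms(1) show ?case by (auto simp: relcompp_apply embeddings_def)
qed auto

text \<open>Embeddings carry walks to walks, so they do not increase the distance to the
  root.\<close>

lemma embedding_in_bverts:
  assumes "f \<in> embeddings (fst H') G" "f (snd H') = v" "verts (fst H') \<subseteq> bverts R H'"
    "u \<in> verts (fst H')"
  shows "f u \<in> bverts R (G, v)"
proof -
  obtain k where "k \<le> R" "(adj (fst H') ^^ k) (snd H') u"
    using assms(3,4) by (auto simp: bverts_def)
  with embedding_relpow[OF assms(1)] assms show ?thesis
    by (force simp: bverts_def embeddings_def)
qed

lemma nbrs_bverts: "w \<in> bverts r x \<Longrightarrow> nbrs (fst x) w \<subseteq> bverts (Suc r) x"
  by (auto simp: bverts_def nbrs_def relcompp_apply dest: adj_verts intro!: exI[of _ "Suc _"])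

lemma nbrs_induce: "v \<in> S \<Longrightarrow> nbrs G v \<subseteq> S \<Longrightarrow> nbrs (induce G S) v = nbrs G v"
  by (auto simp: nbrs_def)

lemma vdeg_induce: "v \<in> S \<Longrightarrow> nbrs G v \<subseteq> S \<Longrightarrow> vdeg (induce G S) v = vdeg G v"
  by (simp add: vdeg_def nbrs_induce)

text \<open>The images lie within distance \<open>R\<close> of \<open>v\<close>. One further layer,
  hence \<open>Suc R\<close>, keeps all neighbours of image vertices inside \<open>S\<close>, so
  their degrees in \<open>induce G S\<close> and in \<open>G\<close> agree. Balls and components are
  both instances of \<open>S\<close>.\<close>

lemma bounded_embs_induce:
  assumes "verts (fst H') \<subseteq> bverts R H'" "bverts (Suc R) (G, v) \<subseteq> S"
  shows "bounded_embs K H' (induce G S) v = bounded_embs K H' G v"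
proof -
  have loc: "f u \<in> S" "vdeg (induce G S) (f u) = vdeg G (f u)"
    if "f \<in> embeddings (fst H') G" "f (snd H') = v" "u \<in> verts (fst H')" for f u
  proof -
    have *: "f u \<in> bverts R (G, v)" using embedding_in_bverts[OF that(1,2) assms(1) that(3)] .
    show "f u \<in> S" using * assms(2) bverts_mono[of R "Suc R" "(G, v)"] by auto
    then show "vdeg (induce G S) (f u) = vdeg G (f u)"
      using nbrs_bverts[OF *] assms(2) by (intro vdeg_induce) auto
  qed
  have sub: "embeddings (fst H') (induce G S) \<subseteq> embeddings (fst H') G"
    by (auto simp: embeddings_def PiE_def Pi_def)
  have sup: "f \<in> embeddings (fst H') (induce G S)"
    if "f \<in> embeddings (fst H') G" "f (snd H') = v" for f
    using that loc(1)[OF that] by (auto simp: embeddings_def PiE_def Pi_def dest: adj_verts)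
  show ?thesis
    unfolding bounded_embs_def using sub sup loc(2) by auto
qed

lemma bounded_emb_rball:
  assumes "verts (fst H') \<subseteq> bverts R H'"
  shows "bounded_emb K H' (fst (rball (Suc R) x)) (snd x) = bounded_emb K H' (fst x) (snd x)"
  by (simp add: bounded_emb_def rball_alt bounded_embs_induce[OF assms])

lemma bverts_component: "bverts r (G, v) \<subseteq> {w \<in> verts G. (adj G)\<^sup>*\<^sup>* v w}"
  by (auto simp: bverts_def rtranclp_power)

lemma bounded_emb_component:
  assumes "verts (fst H') \<subseteq> bverts R H'"
  shows "bounded_emb K H' (component G v) v = bounded_emb K H' G v"
  by (simp add: bounded_emb_def component_def bounded_embs_induce[OF assms bverts_component])

lemma vdeg_component: "v \<in> verts G \<Longrightarrow> vdeg (component G v) v = vdeg G v"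
  unfolding component_def by (rule vdeg_induce) (auto simp: nbrs_def dest: adj_verts)

lemma vdeg_rball: "snd x \<in> verts (fst x) \<Longrightarrow> vdeg (fst (rball (Suc 0) x)) (snd x) = vdeg (fst x) (snd x)"
  unfolding rball_alt fst_conv
  by (rule vdeg_induce) (use nbrs_bverts[of "snd x" 0 x] root_in_bverts[of x] in auto)

text \<open>Composition with an isomorphism is a bijection between rooted embeddings, and it
  preserves the degree of each image vertex, so the truncation condition transfers in both
  directions.\<close>

lemma bounded_emb_iso:
  assumes "rooted_iso x y" and rx: "snd x \<in> verts (fst x)" and rH: "snd H' \<in> verts (fst H')"
  shows "bounded_emb K H' (fst x) (snd x) = bounded_emb K H' (fst y) (snd y)"
proof -
  obtain f where f: "is_rooted_iso f x y" using assms by (auto simp: rooted_iso_def)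
  let ?\<Phi> = "\<lambda>e. restrict (f \<circ> e) (verts (fst H'))"
  have b: "bij_betw ?\<Phi> {e \<in> embeddings (fst H') (fst x). e (snd H') = snd x}
      {e \<in> embeddings (fst H') (fst y). e (snd H') = snd y}" (is "bij_betw _ ?A ?B")
    using bij_betw_rooted_emb[OF f rx rH] .
  have deg: "vdeg (fst y) (?\<Phi> e u) = vdeg (fst x) (e u)"
    if "e \<in> ?A" "u \<in> verts (fst H')" for e u
  proof -
    have "e u \<in> verts (fst x)" using that by (auto simp: embeddings_def)
    from bij_betw_same_card[OF is_rooted_iso_nbrs[OF f this]] that show ?thesis
      by (simp add: vdeg_def)
  qed
  have "bij_betw ?\<Phi> {e \<in> ?A. \<forall>u\<in>verts (fst H'). vdeg (fst x) (e u) \<le> K}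
      {e \<in> ?B. \<forall>u\<in>verts (fst H'). vdeg (fst y) (e u) \<le> K}"
    unfolding bij_betw_def
  proof
    show "inj_on ?\<Phi> {e \<in> ?A. \<forall>u\<in>verts (fst H'). vdeg (fst x) (e u) \<le> K}"
      using b by (auto simp: bij_betw_def intro: inj_on_subset)
    have "(\<forall>u\<in>verts (fst H'). vdeg (fst x) (e u) \<le> K) \<longleftrightarrow>
        (\<forall>u\<in>verts (fst H'). vdeg (fst y) (?\<Phi> e u) \<le> K)" if "e \<in> ?A" for e
      using deg[OF that] by (metis (no_types, lifting))
    moreover have "?\<Phi> ` ?A = ?B" using b by (simp only: bij_betw_def)
    ultimately show "?\<Phi> ` {e \<in> ?A. \<forall>u\<in>verts (fst H'). vdeg (fst x) (e u) \<le> K} =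
        {e \<in> ?B. \<forall>u\<in>verts (fst H'). vdeg (fst y) (e u) \<le> K}"
      by (smt (verit) Collect_cong image_iff mem_Collect_eq set_eq_iff)
  qed
  from bij_betw_same_card[OF this] show ?thesis
    unfolding bounded_emb_def bounded_embs_def by (simp add: conj_assoc)
qed

section \<open>Counting maps by exploring a connected graph\<close>

definition rooted_homs :: "'a ugraph \<Rightarrow> 'a \<Rightarrow> 'b ugraph \<Rightarrow> 'b \<Rightarrow> nat \<Rightarrow> 'a set \<Rightarrow> ('a \<Rightarrow> 'b) set" where
  "rooted_homs H u G w D S = {g \<in> S \<rightarrow>\<^sub>E verts G. g u = w \<and> (\<forall>x\<in>S. vdeg G (g x) \<le> D) \<and>
     (\<forall>x\<in>S. \<forall>y\<in>S. adj H x y \<longrightarrow> adj G (g x) (g y))}"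

text \<open>A map on \<open>insert b S\<close> is determined by its restriction \<open>g\<close> to
  \<open>S\<close> and by the image of \<open>b\<close>. That image is a neighbour of
  \<open>g a\<close>, which has at most \<open>D\<close> neighbours.\<close>

lemma rooted_homs_insert:
  assumes "a \<in> S" "b \<notin> S" "u \<in> S" "adj H a b" "loc_finite G" "finite (rooted_homs H u G w D S)"
  shows "finite (rooted_homs H u G w D (insert b S))"
    and "card (rooted_homs H u G w D (insert b S)) \<le> D * card (rooted_homs H u G w D S)"
proof -
  let ?F = "rooted_homs H u G w D"
  let ?\<Phi> = "\<lambda>g. (restrict g S, g b)"
  let ?T = "SIGMA g:?F S. nbrs G (g a)"
  have fin: "finite (nbrs G (g a))" if "g \<in> ?F S" for g
    using that assms(1,5) by (auto simp: rooted_homs_def loc_finite_def)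
  have finT: "finite ?T" using assms(6) fin by auto
  have sub: "?\<Phi> ` ?F (insert b S) \<subseteq> ?T"
    using assms(1-4) by (auto simp: rooted_homs_def nbrs_def PiE_def)
  have inj: "inj_on ?\<Phi> (?F (insert b S))"
  proof (rule inj_onI, rule ext)
    fix g g' x assume g: "g \<in> ?F (insert b S)" "g' \<in> ?F (insert b S)" "?\<Phi> g = ?\<Phi> g'"
    consider "x \<in> S" | "x = b" | "x \<notin> insert b S" by auto
    then show "g x = g' x"
    proof cases
      case 1
      then show ?thesis using g(3) by (metis fst_conv restrict_apply')
    next
      case 3
      then show ?thesis using g(1,2) unfolding rooted_homs_def by (auto simp: PiE_def extensional_def)
    qed (use g in auto)
  qed
  show "finite (?F (insert b S))" using inj_on_finite[OF inj sub finT] .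
  have "card (?F (insert b S)) \<le> card ?T" using card_inj_on_le[OF inj sub finT] .
  also have "\<dots> = (\<Sum>g\<in>?F S. card (nbrs G (g a)))"
    using assms(6) fin by (intro card_SigmaI) auto
  also have "\<dots> \<le> (\<Sum>g\<in>?F S. D)"
    using assms(1) by (intro sum_mono) (auto simp: rooted_homs_def vdeg_def)
  finally show "card (?F (insert b S)) \<le> D * card (?F S)" by (simp add: mult.commute)
qed

text \<open>Otherwise \<open>S\<close> would be closed under adjacency and would contain everything
  reachable from it, that is, all of \<open>H\<close>.\<close>

lemma connected_boundary:
  assumes "graph_connected H" "S \<subseteq> verts H" "S \<noteq> {}" "S \<noteq> verts H"
  shows "\<exists>a\<in>S. \<exists>b\<in>verts H - S. adj H a b"
proof (rule ccontr)
  assume no: "\<not> ?thesis"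
  obtain u w where uw: "u \<in> S" "w \<in> verts H - S" using assms by auto
  have "(adj H)\<^sup>*\<^sup>* u w" using assms uw by (auto simp: graph_connected_def)
  then have "w \<in> S"
  proof induction
    case (step y z)
    then show ?case using no by (auto dest: adj_verts)
  qed (use uw in simp)
  then show False using uw by simp
qed

text \<open>Exploring \<open>H\<close> from \<open>u\<close> one vertex at a time, each new vertex has at most \<open>D\<close> possible images.\<close>

lemma rooted_homs_bound:
  assumes "graph_connected H" "finite (verts H)" "u \<in> verts H" "loc_finite G"
  shows "finite (rooted_homs H u G w D (verts H)) \<and>
    card (rooted_homs H u G w D (verts H)) \<le> D ^ (card (verts H) - 1)"
proof -
  let ?F = "rooted_homs H u G w D"
  \<comment> \<open>The exponent is one less than \<open>card S\<close> because the image of the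
    first vertex \<open>u\<close> is prescribed.\<close>
  have "\<exists>S\<subseteq>verts H. u \<in> S \<and> card S = Suc k \<and> finite (?F S) \<and> card (?F S) \<le> D ^ k"
    if "Suc k \<le> card (verts H)" for k
    using that
  proof (induction k)
    case 0
    have "?F {u} \<subseteq> {\<lambda>_\<in>{u}. w}"
      by (auto simp: rooted_homs_def PiE_def extensional_def fun_eq_iff)
    then have "finite (?F {u}) \<and> card (?F {u}) \<le> 1"
      using finite_subset card_mono[of "{\<lambda>_\<in>{u}. w}" "?F {u}"] by auto
    then show ?case using assms(3) by (intro exI[of _ "{u}"]) auto
  next
    case (Suc k)
    then obtain S where S: "S \<subseteq> verts H" "u \<in> S" "card S = Suc k" "finite (?F S)" "card (?F S) \<le> D ^ k"
      by auto
    have finS: "finite S" using S(1) assms(2) finite_subset by blast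
    have "S \<noteq> verts H" using S(3) Suc.prems by auto
    then obtain a b where ab: "a \<in> S" "b \<in> verts H" "b \<notin> S" "adj H a b"
      using connected_boundary[OF assms(1) S(1)] S(2) by auto
    note ins = rooted_homs_insert[OF ab(1,3) S(2) ab(4) assms(4) S(4)]
    have "card (?F (insert b S)) \<le> D ^ Suc k"
      using order_trans[OF ins(2) mult_le_mono2[OF S(5)]] by simp
    then show ?case using S ab ins(1) finS by (intro exI[of _ "insert b S"]) auto
  qed
  moreover have "Suc (card (verts H) - 1) = card (verts H)"
    using assms(2,3) by (metis Suc_diff_1 card_gt_0_iff empty_iff)
  ultimately obtain S where "S \<subseteq> verts H" "card S = card (verts H)"
      "finite (?F S)" "card (?F S) \<le> D ^ (card (verts H) - 1)"
    by (metis order_refl)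
  moreover from this have "S = verts H" using card_subset_eq[OF assms(2)] by blast
  ultimately show ?thesis by simp
qed

text \<open>Forgetting injectivity turns these embeddings into the maps counted by the exploration;
  an upper bound survives this relaxation.\<close>

lemma bounded_embs_bound:
  assumes "graph_connected H" "finite (verts H)" "u \<in> verts H" "loc_finite G"
  shows "finite (bounded_embs D (H, u) G w)"
    and "card (bounded_embs D (H, u) G w) \<le> D ^ (card (verts H) - 1)"
proof -
  have "bounded_embs D (H, u) G w \<subseteq> rooted_homs H u G w D (verts H)"
    by (auto simp: bounded_embs_def embeddings_def rooted_homs_def)
  with rooted_homs_bound[OF assms, of w D]
  show "finite (bounded_embs D (H, u) G w)"
    "card (bounded_embs D (H, u) G w) \<le> D ^ (card (verts H) - 1)"
    by (auto intro: finite_subset order_trans[OF card_mono])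
qed

section \<open>Unrooted counts as sums over the image of the root\<close>

lemma finite_embeddings:
  assumes "finite (verts H)" "finite (verts G)"
  shows "finite (embeddings H G)"
  by (rule finite_subset[of _ "verts H \<rightarrow>\<^sub>E verts G"])
    (use assms in \<open>auto simp: embeddings_def intro: finite_PiE\<close>)

text \<open>Embeddings are partitioned by the image of \<open>u\<close>. The predicate
  \<open>P\<close> serves both the full count and the count restricted to small degrees.\<close>

lemma card_embeddings_by_root:
  assumes "finite (verts H)" "finite (verts G)" "u \<in> verts H"
  shows "card {f \<in> embeddings H G. P f} = (\<Sum>v\<in>verts G. card {f \<in> embeddings H G. f u = v \<and> P f})"
proof -
  have "{f \<in> embeddings H G. P f} = (\<Union>v\<in>verts G. {f \<in> embeddings H G. f u = v \<and> P f})"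
    using assms(3) by (auto simp: embeddings_def)
  also have "card \<dots> = (\<Sum>v\<in>verts G. card {f \<in> embeddings H G. f u = v \<and> P f})"
    using assms finite_embeddings[OF assms(1,2)] by (intro card_UN_disjoint) auto
  finally show ?thesis .
qed

lemma emb_eq_sum_rooted_emb:
  assumes "finite (verts H)" "finite (verts G)" "u \<in> verts H"
  shows "emb H G = (\<Sum>v\<in>verts G. rooted_emb (H, u) G v)"
  using card_embeddings_by_root[OF assms, of "\<lambda>_. True"] by (simp add: emb_def rooted_emb_def)

lemma sum_bounded_emb_le_emb:
  assumes "finite (verts H)" "finite (verts G)" "u \<in> verts H"
  shows "(\<Sum>v\<in>verts G. bounded_emb K (H, u) G v) \<le> emb H G"
proof -
  have "(\<Sum>v\<in>verts G. bounded_emb K (H, u) G v) =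
      card {f \<in> embeddings H G. \<forall>x\<in>verts H. vdeg G (f x) \<le> K}"
    unfolding bounded_emb_def bounded_embs_def fst_conv snd_conv
    using card_embeddings_by_root[OF assms, symmetric] .
  also have "\<dots> \<le> emb H G"
    unfolding emb_def using finite_embeddings[OF assms(1,2)] by (intro card_mono) auto
  finally show ?thesis .
qed

text \<open>An embedding that meets a vertex of degree above \<open>K\<close> is charged to an image vertex \<open>w\<close> of
  maximal degree: from \<open>w\<close>, there are at most \<open>vdeg G w ^ (h - 1)\<close> ways to complete it.\<close>

lemma emb_le_sum_bounded_emb:
  assumes H: "graph_connected H" "finite (verts H)" and G: "finite (verts G)" and u: "u \<in> verts H"
  shows "emb H G \<le> (\<Sum>v\<in>verts G. bounded_emb K (H, u) G v) +
    card (verts H) * (\<Sum>w\<in>{w\<in>verts G. K < vdeg G w}. vdeg G w ^ (card (verts H) - 1))"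
proof -
  let ?B = "{w\<in>verts G. K < vdeg G w}"
  let ?low = "{f \<in> embeddings H G. \<forall>x\<in>verts H. vdeg G (f x) \<le> K}"
  \<comment> \<open>The vertex \<open>x\<close> of \<open>H\<close> whose image has maximal degree
    is unknown; the union over \<open>x\<close> costs the factor \<open>card (verts H)\<close>. The
    bound at \<open>w\<close> is its own degree, not a common constant.\<close>
  let ?high = "\<Union>x\<in>verts H. \<Union>w\<in>?B. bounded_embs (vdeg G w) (H, x) G w"
  note lf = finite_verts_loc_finite[OF G]
  have "embeddings H G \<subseteq> ?low \<union> ?high"
  proof
    fix f assume f: "f \<in> embeddings H G"
    have "Max ((\<lambda>y. vdeg G (f y)) ` verts H) \<in> (\<lambda>y. vdeg G (f y)) ` verts H"
      using H(2) u by (intro Max_in) auto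
    then obtain x where x: "x \<in> verts H" "vdeg G (f x) = Max ((\<lambda>y. vdeg G (f y)) ` verts H)"
      by auto
    then have x: "x \<in> verts H" "\<And>y. y \<in> verts H \<Longrightarrow> vdeg G (f y) \<le> vdeg G (f x)"
      using H(2) by auto
    show "f \<in> ?low \<union> ?high"
    proof (cases "vdeg G (f x) \<le> K")
      case True
      then show ?thesis using f x(2) order_trans by auto
    next
      case False
      then have "f x \<in> ?B" using f x(1) by (auto simp: embeddings_def)
      moreover have "f \<in> bounded_embs (vdeg G (f x)) (H, x) G (f x)"
        using f x(2) by (simp add: bounded_embs_def)
      ultimately show ?thesis using x(1) by blast
    qed
  qed
  moreover have "finite (?low \<union> ?high)"
    using H(2) G finite_embeddings[OF H(2) G] bounded_embs_bound(1)[OF H _ lf] by auto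
  ultimately have "emb H G \<le> card (?low \<union> ?high)"
    unfolding emb_def by (intro card_mono)
  also have "\<dots> \<le> card ?low + card ?high" by (rule card_Un_le)
  also have "card ?high \<le> (\<Sum>x\<in>verts H. \<Sum>w\<in>?B. card (bounded_embs (vdeg G w) (H, x) G w))"
    using H(2) G by (intro order_trans[OF card_UN_le] sum_mono) auto
  also have "\<dots> \<le> (\<Sum>x\<in>verts H. \<Sum>w\<in>?B. vdeg G w ^ (card (verts H) - 1))"
    by (intro sum_mono bounded_embs_bound(2)[OF H _ lf])
  also have "\<dots> = card (verts H) * (\<Sum>w\<in>?B. vdeg G w ^ (card (verts H) - 1))" by simp
  also have "card ?low = (\<Sum>v\<in>verts G. bounded_emb K (H, u) G v)"
    unfolding bounded_emb_def bounded_embs_def fst_conv snd_conv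
    using card_embeddings_by_root[OF H(2) G u] .
  finally show ?thesis by simp
qed

section \<open>Bounded counts as the degree bound grows\<close>

lemma finite_rooted_embeddings:
  assumes "finite (verts (fst H'))" "verts (fst H') \<subseteq> bverts R H'" "loc_finite G"
  shows "finite {f \<in> embeddings (fst H') G. f (snd H') = v}"
proof (rule finite_subset)
  \<comment> \<open>\<open>G\<close> may be infinite, but all images stay in one ball, which is
    finite by local finiteness.\<close>
  show "{f \<in> embeddings (fst H') G. f (snd H') = v} \<subseteq> verts (fst H') \<rightarrow>\<^sub>E bverts R (G, v)"
  proof
    fix f assume f: "f \<in> {f \<in> embeddings (fst H') G. f (snd H') = v}"
    then have "f u \<in> bverts R (G, v)" if "u \<in> verts (fst H')" for u
      using embedding_in_bverts[of f H' G v R u] assms(2) that by simp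
    with f show "f \<in> verts (fst H') \<rightarrow>\<^sub>E bverts R (G, v)"
      by (auto simp: embeddings_def PiE_def)
  qed
  show "finite (verts (fst H') \<rightarrow>\<^sub>E bverts R (G, v))"
    using assms by (intro finite_PiE finite_bverts) auto
qed

lemma bounded_emb_mono:
  assumes "finite (verts (fst H'))" "verts (fst H') \<subseteq> bverts R H'" "loc_finite G" "K \<le> L"
  shows "bounded_emb K H' G v \<le> bounded_emb L H' G v"
  unfolding bounded_emb_def
proof (rule card_mono)
  show "finite (bounded_embs L H' G v)"
    using finite_rooted_embeddings[OF assms(1-3), of v]
    by (rule rev_finite_subset) (auto simp: bounded_embs_def)
  show "bounded_embs K H' G v \<subseteq> bounded_embs L H' G v"
    using assms(4) by (auto simp: bounded_embs_def)
qed

text \<open>Only finitely many rooted embeddings exist, so the degrees they meet have a maximum;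
  from there on the truncation removes nothing.\<close>

lemma bounded_emb_eventually:
  assumes "finite (verts (fst H'))" "verts (fst H') \<subseteq> bverts R H'" "loc_finite G"
  shows "\<forall>\<^sub>F K in sequentially. bounded_emb K H' G v = rooted_emb H' G v"
proof -
  let ?A = "{f \<in> embeddings (fst H') G. f (snd H') = v}"
  \<comment> \<open>Inserting \<open>0\<close> keeps \<open>Max\<close> meaningful when there is no
    embedding at all.\<close>
  define D where "D = Max (insert 0 ((\<lambda>(f, u). vdeg G (f u)) ` (?A \<times> verts (fst H'))))"
  have fin: "finite ((\<lambda>(f, u). vdeg G (f u)) ` (?A \<times> verts (fst H')))"
    using finite_rooted_embeddings[OF assms, of v] assms(1) by blast
  have D: "vdeg G (f u) \<le> D" if "f \<in> ?A" "u \<in> verts (fst H')" for f u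
    unfolding D_def using fin that by (intro Max_ge) auto
  have "bounded_emb K H' G v = rooted_emb H' G v" if "D \<le> K" for K
  proof -
    have "bounded_embs K H' G v = ?A"
      unfolding bounded_embs_def using D that order_trans by fastforce
    then show ?thesis by (simp add: bounded_emb_def rooted_emb_def)
  qed
  then show ?thesis by (auto simp: eventually_sequentially)
qed

text \<open>Each vertex is reached from the root by some finite walk, and the maximum of finitely
  many such lengths is a common radius.\<close>

lemma connected_radius:
  assumes "graph_connected (fst H')" "finite (verts (fst H'))" "snd H' \<in> verts (fst H')"
  shows "\<exists>R. verts (fst H') \<subseteq> bverts R H'"
proof -
  have "clf_rgraph H'"
    using assms finite_verts_loc_finite by (simp add: clf_rgraph_def)
  note UN = clf_verts_UN[OF this]
  have "\<exists>r. u \<in> bverts r H'" if "u \<in> verts (fst H')" for u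
    using that UN by auto
  then obtain r where r: "\<And>u. u \<in> verts (fst H') \<Longrightarrow> u \<in> bverts (r u) H'" by metis
  have "u \<in> bverts (Max (r ` verts (fst H'))) H'" if "u \<in> verts (fst H')" for u
    using r[OF that] bverts_mono[of "r u" "Max (r ` verts (fst H'))" H'] that assms(2) by auto
  then show ?thesis by blast
qed

section \<open>Stars\<close>

text \<open>The parameter counts all vertices: for \<open>h > 0\<close> there is the centre
  \<open>0\<close> and \<open>h - 1\<close> leaves.\<close>

lift_definition star :: "nat \<Rightarrow> nat ugraph" is
  "\<lambda>h. ({..<h}, \<lambda>u v. u \<noteq> v \<and> u < h \<and> v < h \<and> (u = 0 \<or> v = 0))"
  by auto

lemma verts_star [simp]: "verts (star h) = {..<h}"
  by transfer simp

lemma adj_star [simp]: "adj (star h) u v \<longleftrightarrow> u \<noteq> v \<and> u < h \<and> v < h \<and> (u = 0 \<or> v = 0)"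
  by transfer simp

lemma star_connected:
  assumes "0 < h"
  shows "graph_connected (star h)"
proof -
  have "(adj (star h))\<^sup>*\<^sup>* u 0 \<and> (adj (star h))\<^sup>*\<^sup>* 0 u" if "u < h" for u
    using that assms by (cases "u = 0") auto
  then show ?thesis
    using assms unfolding graph_connected_def by (auto intro: rtranclp_trans)
qed

text \<open>Once the centre is sent to \<open>v\<close>, an embedding is an injective choice of
  \<open>h - 1\<close> neighbours of \<open>v\<close>. Truncated subtraction gives the right value
  \<open>0\<close> when the degree is below \<open>h - 1\<close>.\<close>

lemma rooted_emb_star:
  assumes "0 < h" "v \<in> verts G" "finite (nbrs G v)"
  shows "rooted_emb (star h, 0) G v = (\<Prod>i<h-1. vdeg G v - i)"
proof -
  let ?A = "{f \<in> embeddings (star h) G. f 0 = v}"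
  let ?B = "{g \<in> {1..<h} \<rightarrow>\<^sub>E nbrs G v. inj_on g {1..<h}}"
  have v: "v \<notin> nbrs G v" by (simp add: nbrs_def)
  have V: "{..<h} = insert 0 {1..<h}" using assms(1) by auto
  have "bij_betw (\<lambda>f. restrict f {1..<h}) ?A ?B"
  \<comment> \<open>The inverse puts \<open>v\<close> back at the centre; injectivity is kept since
    \<open>v\<close> is not its own neighbour.\<close>
  proof (rule bij_betw_byWitness[where f' = "\<lambda>g. g(0 := v)"]; intro ballI subsetI)
    fix f assume "f \<in> ?A"
    then show "(restrict f {1..<h})(0 := v) = f"
      by (auto simp: embeddings_def fun_eq_iff PiE_def extensional_def)
  next
    fix g assume "g \<in> ?B"
    then show "restrict (g(0 := v)) {1..<h} = g"
      by (auto simp: fun_eq_iff PiE_def extensional_def)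
  next
    fix g assume "g \<in> (\<lambda>f. restrict f {1..<h}) ` ?A"
    then obtain f where f: "f \<in> ?A" "g = restrict f {1..<h}" by auto
    then have "inj_on f {..<h}" by (simp add: embeddings_def)
    then have "inj_on f {1..<h}" by (rule inj_on_subset) auto
    then show "g \<in> ?B" using f assms(1) by (auto simp: embeddings_def nbrs_def)
  next
    fix f assume "f \<in> (\<lambda>g. g(0 := v)) ` ?B"
    then obtain g where g: "g \<in> ?B" "f = g(0 := v)" by auto
    have gn: "g u \<in> nbrs G v" if "u \<in> {1..<h}" for u using g(1) that by auto
    have "inj_on f {..<h}"
      unfolding V g(2) using g(1) gn v by (auto simp: inj_on_def)
    moreover have "adj G (f a) (f b)" if "adj (star h) a b" for a b
      using that gn[of a] gn[of b] unfolding g(2) by (auto simp: nbrs_def intro: adj_sym)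
    moreover have "f \<in> {..<h} \<rightarrow>\<^sub>E verts G"
      using g(1) gn assms(1,2) nbrs_subset_verts[of G v] unfolding g(2) V
      by (auto simp: PiE_def extensional_def)
    ultimately show "f \<in> ?A" using g(2) by (auto simp: embeddings_def)
  qed
  then have "rooted_emb (star h, 0) G v = card ?B"
    unfolding rooted_emb_def fst_conv snd_conv by (rule bij_betw_same_card)
  also have "\<dots> = prod ((-) (card (nbrs G v))) {0..<card {1..<h}}"
    by (subst card_inj_on_subset_funcset) (use assms in auto)
  finally show ?thesis by (simp add: vdeg_def atLeast0LessThan)
qed

section \<open>Local functionals and truncation\<close>

definition vmean :: "'a ugraph \<Rightarrow> ('a \<Rightarrow> real) \<Rightarrow> real" where
  "vmean G f = (\<Sum>v\<in>verts G. f v) / card (verts G)"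

lemma vmean_mono: "(\<And>v. v \<in> verts G \<Longrightarrow> f v \<le> g v) \<Longrightarrow> vmean G f \<le> vmean G g"
  unfolding vmean_def by (intro divide_right_mono sum_mono) auto

lemma vmean_cong: "(\<And>v. v \<in> verts G \<Longrightarrow> f v = g v) \<Longrightarrow> vmean G f = vmean G g"
  unfolding vmean_def by (simp cong: sum.cong)

lemma vmean_nonneg: "(\<And>v. v \<in> verts G \<Longrightarrow> 0 \<le> f v) \<Longrightarrow> 0 \<le> vmean G f"
  unfolding vmean_def by (intro divide_nonneg_nonneg sum_nonneg) auto

lemma vmean_add: "vmean G (\<lambda>v. f v + g v) = vmean G f + vmean G g"
  by (simp add: vmean_def sum.distrib add_divide_distrib)

lemma vmean_cmult: "vmean G (\<lambda>v. c * f v) = c * vmean G f"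
  by (simp add: vmean_def sum_distrib_left)

lemma integral_unif_vertex:
  assumes "finite (verts G)" "verts G \<noteq> {}"
  shows "(\<integral>v. f v \<partial>unif_vertex G) = vmean G f"
  using assms by (simp add: unif_vertex_def vmean_def integral_pmf_of_set)

lemma nn_integral_unif_vertex:
  assumes "finite (verts G)" "verts G \<noteq> {}" "\<And>v. 0 \<le> f v"
  shows "(\<integral>\<^sup>+v. ennreal (f v) \<partial>unif_vertex G) = ennreal (vmean G f)"
proof -
  have "(\<integral>\<^sup>+v. ennreal (f v) \<partial>unif_vertex G) = (\<Sum>v\<in>verts G. ennreal (f v)) / card (verts G)"
    using assms by (simp add: unif_vertex_def nn_integral_pmf_of_set)
  also have "\<dots> = ennreal (vmean G f)"
    using assms
    by (simp add: vmean_def sum_ennreal divide_ennreal sum_nonneg card_gt_0_iff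
        flip: ennreal_of_nat_eq_real_of_nat)
       (metis (no_types, lifting) card_gt_0_iff divide_ennreal ennreal_of_nat_eq_real_of_nat
          of_nat_0_less_iff sum_nonneg)
  finally show ?thesis .
qed

text \<open>Such an \<open>F\<close> is locally constant: graphs at distance below
  \<open>1 / 2 ^ r\<close> have isomorphic balls of radius \<open>r\<close>. This gives continuity
  for any target topology.\<close>

lemma continuous_on_gstar_if_local:
  fixes F :: "gstar \<Rightarrow> 'b::topological_space"
  assumes "\<And>X Y. rooted_iso (rball r (rep_gstar X)) (rball r (rep_gstar Y)) \<Longrightarrow> F X = F Y"
  shows "continuous_on UNIV F"
proof -
  have "F Y = F X" if "dist Y X < 1 / 2 ^ r" for X Y
  proof -
    have "dloc (rep_gstar Y) (rep_gstar X) \<le> 1 / 2 ^ r" using that by (simp add: dist_gstar_def)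
    then show ?thesis
      using assms dloc_le_iff[OF clf_rep_gstar clf_rep_gstar] by blast
  qed
  then have "\<forall>\<^sub>F Y in at X. F Y = F X" for X
    by (auto simp: eventually_at intro!: exI[of _ "1 / 2 ^ r"])
  then have "(F \<longlongrightarrow> F X) (at X)" for X
    by (rule tendsto_eventually)
  then show ?thesis by (simp add: continuous_on)
qed

lemma rep_gstar_root: "snd (rep_gstar X) \<in> verts (fst (rep_gstar X))"
  using clf_rep_gstar[of X] by (simp add: clf_rgraph_def)

text \<open>The ball of radius 1 already shows the degree of the root, so any function of it is
  local.\<close>

lemma continuous_on_root_deg:
  fixes \<phi> :: "nat \<Rightarrow> 'b::topological_space"
  shows "continuous_on UNIV (\<lambda>X. \<phi> (root_deg X))"
proof (rule continuous_on_gstar_if_local[of "Suc 0"])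
  fix X Y assume "rooted_iso (rball (Suc 0) (rep_gstar X)) (rball (Suc 0) (rep_gstar Y))"
  then have "vdeg (fst (rball (Suc 0) (rep_gstar X))) (snd (rep_gstar X)) =
      vdeg (fst (rball (Suc 0) (rep_gstar Y))) (snd (rep_gstar Y))"
    using vdeg_rooted_iso[of "rball (Suc 0) (rep_gstar X)" "rball (Suc 0) (rep_gstar Y)"]
      root_in_bverts[OF rep_gstar_root] by simp
  then show "\<phi> (root_deg X) = \<phi> (root_deg Y)"
    by (simp add: root_deg_def vdeg_rball rep_gstar_root)
qed

definition root_bounded_emb :: "nat \<Rightarrow> 'a rgraph \<Rightarrow> gstar \<Rightarrow> nat" where
  "root_bounded_emb K H' X = bounded_emb K H' (fst (rep_gstar X)) (snd (rep_gstar X))"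

text \<open>The ball of radius \<open>Suc R\<close> decides the count: radius \<open>R\<close> for
  the images, one more layer for their degrees.\<close>

lemma continuous_on_root_bounded_emb:
  fixes \<phi> :: "nat \<Rightarrow> 'b::topological_space"
  assumes "verts (fst H') \<subseteq> bverts R H'" "snd H' \<in> verts (fst H')"
  shows "continuous_on UNIV (\<lambda>X. \<phi> (root_bounded_emb K H' X))"
proof (rule continuous_on_gstar_if_local[of "Suc R"])
  fix X Y assume iso: "rooted_iso (rball (Suc R) (rep_gstar X)) (rball (Suc R) (rep_gstar Y))"
  show "\<phi> (root_bounded_emb K H' X) = \<phi> (root_bounded_emb K H' Y)"
    using bounded_emb_iso[OF iso _ assms(2), of K] root_in_bverts[OF rep_gstar_root[of X], of "Suc R"]
    by (simp add: root_bounded_emb_def bounded_emb_rball[OF assms(1)])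
qed

lemma root_bounded_emb_gstar_of:
  assumes "clf_rgraph x" "snd H' \<in> verts (fst H')"
  shows "root_bounded_emb K H' (gstar_of x) = bounded_emb K H' (fst x) (snd x)"
  unfolding root_bounded_emb_def
  by (rule bounded_emb_iso[OF rooted_iso_rep_gstar_of, symmetric])
    (use assms in \<open>auto simp: clf_rgraph_def\<close>)

text \<open>Lower bounds \<open>x K\<close>, with errors \<open>e K\<close> that are uniform in \<open>n\<close>, allow interchanging the
  limits \<open>K \<rightarrow> \<infinity>\<close> and \<open>n \<rightarrow> \<infinity>\<close>, even if \<open>L = \<infinity>\<close> a priori.\<close>

lemma tendsto_uniform_truncation:
  fixes a :: "nat \<Rightarrow> ennreal"
  assumes "\<And>n K. x K n \<le> a n" "\<And>n K. a n \<le> x K n + e K"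
    and "\<And>K. x K \<longlonglongrightarrow> l K" "l \<longlonglongrightarrow> L" "e \<longlonglongrightarrow> 0"
  shows "a \<longlonglongrightarrow> L"
proof -
  have "l K \<le> liminf a" for K
    using lim_imp_Liminf[OF sequentially_bot assms(3)[of K]] Liminf_mono[of "x K" a sequentially] assms(1)
    by simp
  then have "L \<le> liminf a"
    by (intro tendsto_upperbound[OF assms(4)]) auto
  moreover have "limsup a \<le> L"
  proof -
    \<comment> \<open>For fixed \<open>K\<close> first let \<open>n\<close> tend to infinity; only
      afterwards does \<open>K\<close> grow, which removes the error.\<close>
    have "limsup a \<le> l K + e K" for K
    proof -
      have "(\<lambda>n. x K n + e K) \<longlonglongrightarrow> l K + e K" by (intro tendsto_add assms(3)) auto
      from lim_imp_Limsup[OF sequentially_bot this] show ?thesis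
        using Limsup_mono[of a "\<lambda>n. x K n + e K" sequentially] assms(2) by simp
    qed
    moreover have "(\<lambda>K. l K + e K) \<longlonglongrightarrow> L"
      using tendsto_add[OF assms(4,5)] by simp
    ultimately show ?thesis
      by (intro tendsto_lowerbound[of _ L sequentially]) auto
  qed
  ultimately have "limsup a = L" "liminf a = L"
    using Liminf_le_Limsup[OF sequentially_bot, of a] by auto
  then show ?thesis
    by (subst tendsto_iff_Liminf_eq_Limsup) auto
qed

text \<open>The comparison is made factor by factor: for \<open>i < m \<le> d\<close>, the number
  \<open>d - i\<close> is at least \<open>d / m\<close>.\<close>

lemma power_le_falling_factorial:
  assumes "m \<le> d"
  shows "real d ^ m \<le> real m ^ m * real (\<Prod>i<m. d - i)"
proof -
  have "real d \<le> real m * real (d - i)" if "i < m" for i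
  proof -
    obtain j where j: "m = i + 1 + j" using \<open>i < m\<close> less_imp_Suc_add by fastforce
    obtain t where t: "d = m + t" using assms le_Suc_ex by blast
    \<comment> \<open>Here \<open>d - i = 1 + j + t\<close>, so the right side is
      \<open>m + m * (j + t)\<close>, which is at least \<open>m + t\<close> because
      \<open>m\<close> is positive.\<close>
    have "d \<le> m * (d - i)" unfolding t j by (simp add: algebra_simps)
    then show ?thesis by (metis of_nat_le_iff of_nat_mult)
  qed
  then have "(\<Prod>i<m. real d) \<le> (\<Prod>i<m. real m * real (d - i))"
    by (intro prod_mono) auto
  then show ?thesis by (simp add: prod.distrib)
qed

lemma falling_factorial_le_power: "real (\<Prod>i<m. d - i) \<le> real d ^ m"
proof -
  have "(\<Prod>i<m. real (d - i)) \<le> (\<Prod>i<m. real d)" by (intro prod_mono) auto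
  then show ?thesis by simp
qed

text \<open>The cutoff is on the degree itself rather than on its power, so that tails for different
  exponents or weights use the same vertices.\<close>

definition deg_tail :: "nat \<Rightarrow> nat \<Rightarrow> 'a ugraph \<Rightarrow> real" where
  "deg_tail m K G = vmean G (\<lambda>v. if K < vdeg G v then real (vdeg G v) ^ m else 0)"

lemma deg_tail_nonneg: "0 \<le> deg_tail m K G"
  unfolding deg_tail_def by (rule vmean_nonneg) simp

lemma deg_tail_antimono: "K \<le> L \<Longrightarrow> deg_tail m L G \<le> deg_tail m K G"
  unfolding deg_tail_def by (rule vmean_mono) simp

text \<open>For \<open>m > 0\<close>, cutting the power at \<open>K ^ m\<close> is cutting the
  degree at \<open>K\<close>. The supremum of the tails is antitone in the real cutoff, so its limit
  can be read off along the cutoffs \<open>K ^ m\<close>.\<close>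

lemma uniformly_integrable_iff_deg_tail:
  assumes "0 < m" and fin: "\<And>n. finite (verts (G n))" and ne: "\<And>n. verts (G n) \<noteq> {}"
  shows "uniformly_integrable (\<lambda>n. unif_vertex (G n)) (\<lambda>n v. real (vdeg (G n) v) ^ m) \<longleftrightarrow>
    (\<lambda>K. SUP n. ennreal (deg_tail m K (G n))) \<longlonglongrightarrow> 0"
proof -
  define U where "U c = (SUP n. \<integral>\<^sup>+ v. ennreal \<bar>real (vdeg (G n) v) ^ m\<bar> *
    indicator {v. \<bar>real (vdeg (G n) v) ^ m\<bar> > c} v \<partial>unif_vertex (G n))" for c :: real
  have U: "U (real K ^ m) = (SUP n. ennreal (deg_tail m K (G n)))" for K
  proof -
    have less: "real K ^ m < real d ^ m \<longleftrightarrow> K < d" for d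
      unfolding linorder_not_le[symmetric] using power_mono_iff[of "real d" "real K" m] assms(1)
      by (simp only: of_nat_0_le_iff of_nat_le_iff simp_thms)
    have "(\<integral>\<^sup>+ v. ennreal \<bar>real (vdeg (G n) v) ^ m\<bar> *
        indicator {v. \<bar>real (vdeg (G n) v) ^ m\<bar> > real K ^ m} v \<partial>unif_vertex (G n)) =
        ennreal (deg_tail m K (G n))" for n
      unfolding deg_tail_def
      by (subst nn_integral_unif_vertex[OF fin ne, symmetric])
        (auto intro!: nn_integral_cong simp: indicator_def less)
    then show ?thesis by (simp add: U_def)
  qed
  have U_antimono: "U c' \<le> U c" if "c \<le> c'" for c c'
    unfolding U_def using that
    by (intro SUP_mono' nn_integral_mono mult_left_mono) (auto simp: indicator_def)
  have "(U \<longlongrightarrow> 0) at_top \<longleftrightarrow> (\<lambda>K. U (real K ^ m)) \<longlonglongrightarrow> 0"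
  proof
    assume "(U \<longlongrightarrow> 0) at_top"
    moreover have "filterlim (\<lambda>K. real K ^ m) at_top sequentially"
      using assms(1) by (intro filterlim_pow_at_top filterlim_real_sequentially)
    ultimately show "(\<lambda>K. U (real K ^ m)) \<longlonglongrightarrow> 0" by (rule filterlim_compose)
  next
    assume lim: "(\<lambda>K. U (real K ^ m)) \<longlonglongrightarrow> 0"
    show "(U \<longlongrightarrow> 0) at_top"
    proof (rule order_tendstoI)
      fix \<epsilon> :: ennreal assume "0 < \<epsilon>"
      from eventually_happens'[OF sequentially_bot order_tendstoD(2)[OF lim this]]
      obtain K where K: "U (real K ^ m) < \<epsilon>" by auto
      show "\<forall>\<^sub>F c in at_top. U c < \<epsilon>"
        by (rule eventually_mono[OF eventually_ge_at_top le_less_trans[OF U_antimono K]])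
    qed simp
  qed
  moreover have "uniformly_integrable (\<lambda>n. unif_vertex (G n)) (\<lambda>n v. real (vdeg (G n) v) ^ m) \<longleftrightarrow>
      (U \<longlongrightarrow> 0) at_top"
    unfolding uniformly_integrable_def U_def by (simp add: unif_vertex_def)
  ultimately show ?thesis by (simp add: U)
qed

section \<open>Local limits\<close>

locale local_limit = prob_space M for M :: "'w measure" +
  fixes G :: "nat \<Rightarrow> 'a ugraph" and Gstar :: "'w \<Rightarrow> gstar"
  assumes finite_G: "\<And>n. finite (verts (G n))"
    and nonempty_G: "\<And>n. verts (G n) \<noteq> {}"
    and measurable_Gstar [measurable]: "Gstar \<in> borel_measurable M"
    and weak_limit: "weakly_converges (\<lambda>n. local_law (G n)) (distr M borel Gstar)"
begin

section \<open>Limits of averages of local functions\<close>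

lemma loc_finite_G: "loc_finite (G n)"
  using finite_G by (rule finite_verts_loc_finite)

lemma borel_measurable_continuous_Gstar:
  "continuous_on UNIV F \<Longrightarrow> (\<lambda>\<omega>. F (Gstar \<omega>)) \<in> borel_measurable M"
  for F :: "gstar \<Rightarrow> 'b::topological_space"
  by (rule measurable_compose[OF measurable_Gstar borel_measurable_continuous_onI])

text \<open>Weak convergence tested against \<open>F\<close>, with both image measures unfolded;
  \<open>f\<close> is what \<open>F\<close> computes directly in \<open>G n\<close>.\<close>

lemma vmean_tendsto:
  fixes F :: "gstar \<Rightarrow> real"
  assumes F: "continuous_on UNIV F" "\<And>X. \<bar>F X\<bar> \<le> C"
    and f: "\<And>n v. v \<in> verts (G n) \<Longrightarrow> F (gstar_of (component (G n) v, v)) = f n v"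
  shows "(\<lambda>n. vmean (G n) (f n)) \<longlonglongrightarrow> (\<integral>\<omega>. F (Gstar \<omega>) \<partial>M)"
proof -
  have [measurable]: "F \<in> borel_measurable borel"
    using F(1) by (rule borel_measurable_continuous_onI)
  have "bounded (range F)" using F(2) by (auto simp: bounded_iff)
  with weak_limit F(1) have
    "(\<lambda>n. \<integral>X. F X \<partial>local_law (G n)) \<longlonglongrightarrow> (\<integral>X. F X \<partial>distr M borel Gstar)"
    by (simp add: weakly_converges_def)
  moreover have "(\<integral>X. F X \<partial>distr M borel Gstar) = (\<integral>\<omega>. F (Gstar \<omega>) \<partial>M)"
    by (rule integral_distr) auto
  moreover have "(\<integral>X. F X \<partial>local_law (G n)) = vmean (G n) (f n)" for n
  proof -
    have "(\<integral>X. F X \<partial>local_law (G n)) = (\<integral>v. F (gstar_of (component (G n) v, v)) \<partial>unif_vertex (G n))"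
      unfolding local_law_def by (rule integral_distr) (auto simp: unif_vertex_def)
    then show ?thesis
      using f by (simp add: integral_unif_vertex[OF finite_G nonempty_G] cong: vmean_cong)
  qed
  ultimately show ?thesis by simp
qed

lemma vmean_deg_tendsto:
  assumes "\<And>d. \<bar>\<phi> d\<bar> \<le> C"
  shows "(\<lambda>n. vmean (G n) (\<lambda>v. \<phi> (vdeg (G n) v))) \<longlonglongrightarrow> (\<integral>\<omega>. \<phi> (root_deg (Gstar \<omega>)) \<partial>M)"
  by (rule vmean_tendsto[OF continuous_on_root_deg assms])
    (simp add: root_deg_gstar_of[OF clf_component[OF finite_G]] vdeg_component)

text \<open>Common frame for degree moments and embedding counts: weak convergence handles each
  fixed \<open>K\<close>, monotone convergence handles growing \<open>K\<close>, and the error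
  \<open>e K\<close>, uniform in \<open>n\<close>, permits the interchange. The limit may be
  infinite.\<close>

lemma tendsto_nn_integral_if_truncated:
  fixes F :: "nat \<Rightarrow> gstar \<Rightarrow> real" and a :: "nat \<Rightarrow> real"
  assumes F: "\<And>K. continuous_on UNIV (F K)" "\<And>K X. 0 \<le> F K X" "\<And>K X. F K X \<le> C K"
    and f: "\<And>K n v. v \<in> verts (G n) \<Longrightarrow> F K (gstar_of (component (G n) v, v)) = f K n v"
    and mono: "\<And>K X. F K X \<le> F (Suc K) X" and lim: "\<And>X. (\<lambda>K. F K X) \<longlonglongrightarrow> F' X"
    and lower: "\<And>K n. vmean (G n) (f K n) \<le> a n"
    and upper: "\<And>K n. ennreal (a n) \<le> ennreal (vmean (G n) (f K n)) + e K"
    and e: "e \<longlonglongrightarrow> 0"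
  shows "(\<lambda>n. ennreal (a n)) \<longlonglongrightarrow> (\<integral>\<^sup>+\<omega>. ennreal (F' (Gstar \<omega>)) \<partial>M)"
proof (rule tendsto_uniform_truncation[OF _ upper _ _ e])
  show "ennreal (vmean (G n) (f K n)) \<le> ennreal (a n)" for K n
    using lower by (rule ennreal_leI)
  have [measurable]: "(\<lambda>\<omega>. F K (Gstar \<omega>)) \<in> borel_measurable M" for K
    using F(1) by (rule borel_measurable_continuous_Gstar)
  show "(\<lambda>n. ennreal (vmean (G n) (f K n))) \<longlonglongrightarrow> (\<integral>\<^sup>+\<omega>. ennreal (F K (Gstar \<omega>)) \<partial>M)" for K
  proof -
    have "integrable M (\<lambda>\<omega>. F K (Gstar \<omega>))"
      using F(2,3) by (intro integrable_const_bound[of _ "C K"]) auto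
    then have "(\<integral>\<^sup>+\<omega>. ennreal (F K (Gstar \<omega>)) \<partial>M) = ennreal (\<integral>\<omega>. F K (Gstar \<omega>) \<partial>M)"
      using F(2) by (intro nn_integral_eq_integral) auto
    moreover have "(\<lambda>n. vmean (G n) (f K n)) \<longlonglongrightarrow> (\<integral>\<omega>. F K (Gstar \<omega>) \<partial>M)"
      using F(2,3) by (intro vmean_tendsto[OF F(1) _ f, of _ "C K"]) auto
    ultimately show ?thesis by simp
  qed
  show "(\<lambda>K. \<integral>\<^sup>+\<omega>. ennreal (F K (Gstar \<omega>)) \<partial>M) \<longlonglongrightarrow> (\<integral>\<^sup>+\<omega>. ennreal (F' (Gstar \<omega>)) \<partial>M)"
    using mono lim by (intro nn_integral_LIMSEQ) (auto intro!: incseq_SucI le_funI ennreal_leI)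
qed

text \<open>Cutting the moment at degree \<open>K\<close> leaves a bounded local function, and the
  part cut off is exactly \<open>deg_tail\<close>.\<close>

lemma deg_mean_tendsto:
  assumes tail: "(\<lambda>K. SUP n. ennreal (deg_tail m K (G n))) \<longlonglongrightarrow> 0"
    and int: "integrable M (\<lambda>\<omega>. real (root_deg (Gstar \<omega>)) ^ m)"
  shows "(\<lambda>n. vmean (G n) (\<lambda>v. real (vdeg (G n) v) ^ m)) \<longlonglongrightarrow>
    (\<integral>\<omega>. real (root_deg (Gstar \<omega>)) ^ m \<partial>M)"
proof -
  let ?F = "\<lambda>K d. if d \<le> K then real d ^ m else 0"
  have "(\<lambda>n. ennreal (vmean (G n) (\<lambda>v. real (vdeg (G n) v) ^ m))) \<longlonglongrightarrow>
      (\<integral>\<^sup>+\<omega>. ennreal (real (root_deg (Gstar \<omega>)) ^ m) \<partial>M)"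
  proof (rule tendsto_nn_integral_if_truncated[OF _ _ _ _ _ _ _ _ tail,
        where F = "\<lambda>K X. ?F K (root_deg X)" and f = "\<lambda>K n v. ?F K (vdeg (G n) v)"
        and C = "\<lambda>K. real K ^ m"])
    show "continuous_on UNIV (\<lambda>X. ?F K (root_deg X))" for K
      by (rule continuous_on_root_deg)
    show "?F K (root_deg (gstar_of (component (G n) v, v))) = ?F K (vdeg (G n) v)"
      if "v \<in> verts (G n)" for K n v
      using that by (simp add: root_deg_gstar_of[OF clf_component[OF finite_G]] vdeg_component)
    show "(\<lambda>K. ?F K (root_deg X)) \<longlonglongrightarrow> real (root_deg X) ^ m" for X
      by (rule tendsto_eventually) (use eventually_ge_at_top[of "root_deg X"] in eventually_elim, simp)
    show "vmean (G n) (\<lambda>v. ?F K (vdeg (G n) v)) \<le> vmean (G n) (\<lambda>v. real (vdeg (G n) v) ^ m)" for K n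
      by (rule vmean_mono) simp
    show "ennreal (vmean (G n) (\<lambda>v. real (vdeg (G n) v) ^ m)) \<le>
        ennreal (vmean (G n) (\<lambda>v. ?F K (vdeg (G n) v))) + (SUP n. ennreal (deg_tail m K (G n)))" for K n
    proof -
      have "vmean (G n) (\<lambda>v. real (vdeg (G n) v) ^ m) =
          vmean (G n) (\<lambda>v. ?F K (vdeg (G n) v)) + deg_tail m K (G n)"
        unfolding deg_tail_def vmean_add[symmetric] by (rule vmean_cong) simp
      then have "ennreal (vmean (G n) (\<lambda>v. real (vdeg (G n) v) ^ m)) =
          ennreal (vmean (G n) (\<lambda>v. ?F K (vdeg (G n) v))) + ennreal (deg_tail m K (G n))"
        by (simp add: deg_tail_nonneg vmean_nonneg)
      then show ?thesis by (simp only:) (intro add_left_mono SUP_upper, simp)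
    qed
  qed (auto intro: power_mono)
  \<comment> \<open>Integrability makes the limit finite, so that the convergence can be read in the
    reals.\<close>
  moreover have "(\<integral>\<^sup>+\<omega>. ennreal (real (root_deg (Gstar \<omega>)) ^ m) \<partial>M) =
      ennreal (\<integral>\<omega>. real (root_deg (Gstar \<omega>)) ^ m \<partial>M)"
    using int by (intro nn_integral_eq_integral) auto
  ultimately show ?thesis
    by (simp add: vmean_nonneg)
qed

text \<open>If the means of \<open>\<phi>\<close> converge, subtracting those of its bounded part
  shows that its tail means converge to the tail of the limit, which is small for a large cutoff. A
  general \<open>\<phi>\<close> covers both the power and the falling factorial.\<close>

lemma deg_tail_tendsto:
  fixes \<phi> :: "nat \<Rightarrow> real"
  assumes mean: "(\<lambda>n. vmean (G n) (\<lambda>v. \<phi> (vdeg (G n) v))) \<longlonglongrightarrow> (\<integral>\<omega>. \<phi> (root_deg (Gstar \<omega>)) \<partial>M)"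
    and int: "integrable M (\<lambda>\<omega>. \<phi> (root_deg (Gstar \<omega>)))"
    and \<phi>: "\<And>d. K0 \<le> d \<Longrightarrow> real d ^ m \<le> C * \<phi> d"
  shows "(\<lambda>K. SUP n. ennreal (deg_tail m K (G n))) \<longlonglongrightarrow> 0"
proof (rule order_tendstoI)
  fix \<epsilon> :: ennreal assume "0 < \<epsilon>"
  then obtain \<delta> where \<delta>: "0 < \<delta>" "ennreal \<delta> < \<epsilon>"
    by (metis dense ennreal_cases ennreal_less_zero_iff not_less_zero order_less_imp_not_less
        top.not_eq_extremum ennreal_less_top)
  let ?T = "\<lambda>K d. if K < d then \<phi> d else 0"
  have "(\<lambda>K. \<integral>\<omega>. ?T K (root_deg (Gstar \<omega>)) \<partial>M) \<longlonglongrightarrow> (\<integral>\<omega>. 0 \<partial>M)"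
  proof (rule integral_dominated_convergence[where w = "\<lambda>\<omega>. \<bar>\<phi> (root_deg (Gstar \<omega>))\<bar>"])
    show "(\<lambda>\<omega>. ?T K (root_deg (Gstar \<omega>))) \<in> borel_measurable M" for K
      by (rule borel_measurable_continuous_Gstar[OF continuous_on_root_deg])
    show "AE \<omega> in M. (\<lambda>K. ?T K (root_deg (Gstar \<omega>))) \<longlonglongrightarrow> 0"
    proof (rule AE_I2)
      fix \<omega> show "(\<lambda>K. ?T K (root_deg (Gstar \<omega>))) \<longlonglongrightarrow> 0"
        by (rule tendsto_eventually)
          (use eventually_ge_at_top[of "root_deg (Gstar \<omega>)"] in eventually_elim, simp)
    qed
  qed (use int in auto)
  then have "(\<lambda>K. C * (\<integral>\<omega>. ?T K (root_deg (Gstar \<omega>)) \<partial>M)) \<longlonglongrightarrow> 0"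
    using tendsto_mult_right_zero by fastforce
  \<comment> \<open>The cutoff also has to pass \<open>K0\<close>, so that \<open>\<phi>\<close>
    controls the power on the whole tail.\<close>
  then have "\<forall>\<^sub>F K in sequentially. C * (\<integral>\<omega>. ?T K (root_deg (Gstar \<omega>)) \<partial>M) < \<delta> \<and> K0 \<le> K"
    using \<delta>(1) by (intro eventually_conj order_tendstoD(2) eventually_ge_at_top)
  then obtain K where K: "C * (\<integral>\<omega>. ?T K (root_deg (Gstar \<omega>)) \<partial>M) < \<delta>" "K0 \<le> K"
    by (metis (no_types, lifting) eventually_happens' sequentially_bot)
  \<comment> \<open>The tail part may be unbounded, so weak convergence cannot be applied to it
    directly. Its complement \<open>?S\<close> vanishes above \<open>K\<close> and is bounded by a
    finite sum.\<close>
  let ?S = "\<lambda>d. if d \<le> K then \<phi> d else 0"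
  have S_bound: "\<bar>?S d\<bar> \<le> (\<Sum>d\<le>K. \<bar>\<phi> d\<bar>)" for d
    by (auto intro: member_le_sum sum_nonneg)
  have T_eq: "?T K d = \<phi> d - ?S d" for d by simp
  have "integrable M (\<lambda>\<omega>. ?S (root_deg (Gstar \<omega>)))"
  proof (rule integrable_const_bound)
    show "AE \<omega> in M. norm (?S (root_deg (Gstar \<omega>))) \<le> (\<Sum>d\<le>K. \<bar>\<phi> d\<bar>)"
      unfolding real_norm_def using S_bound by (rule AE_I2)
    show "(\<lambda>\<omega>. ?S (root_deg (Gstar \<omega>))) \<in> borel_measurable M"
      by (rule borel_measurable_continuous_Gstar[OF continuous_on_root_deg])
  qed
  then have "(\<integral>\<omega>. ?T K (root_deg (Gstar \<omega>)) \<partial>M) =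
      (\<integral>\<omega>. \<phi> (root_deg (Gstar \<omega>)) \<partial>M) - (\<integral>\<omega>. ?S (root_deg (Gstar \<omega>)) \<partial>M)"
    unfolding T_eq using int by (intro Bochner_Integration.integral_diff)
  moreover have "vmean (G n) (\<lambda>v. ?T K (vdeg (G n) v)) =
      vmean (G n) (\<lambda>v. \<phi> (vdeg (G n) v)) - vmean (G n) (\<lambda>v. ?S (vdeg (G n) v))" for n
  proof -
    have "vmean (G n) (\<lambda>v. \<phi> (vdeg (G n) v)) =
        vmean (G n) (\<lambda>v. ?T K (vdeg (G n) v)) + vmean (G n) (\<lambda>v. ?S (vdeg (G n) v))"
      unfolding vmean_add[symmetric] by (rule vmean_cong) simp
    then show ?thesis by simp
  qed
  ultimately have "(\<lambda>n. vmean (G n) (\<lambda>v. ?T K (vdeg (G n) v))) \<longlonglongrightarrow>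
      (\<integral>\<omega>. ?T K (root_deg (Gstar \<omega>)) \<partial>M)"
    using tendsto_diff[OF mean vmean_deg_tendsto[of ?S, OF S_bound]] by simp
  then have "\<forall>\<^sub>F n in sequentially. C * vmean (G n) (\<lambda>v. ?T K (vdeg (G n) v)) < \<delta>"
    using K(1) by (intro order_tendstoD(2)[OF tendsto_mult_left])
  then obtain N where N: "\<And>n. N \<le> n \<Longrightarrow> C * vmean (G n) (\<lambda>v. ?T K (vdeg (G n) v)) < \<delta>"
    by (auto simp: eventually_sequentially)
  \<comment> \<open>Degrees never exceed the number of vertices, so this cutoff makes the tails of
    the first \<open>N\<close> graphs vanish; for the others it only lowers the tail at
    \<open>K\<close>.\<close>
  define L where "L = K + (\<Sum>n<N. card (verts (G n)))"
  have "deg_tail m L (G n) \<le> \<delta>" for n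
  proof (cases "N \<le> n")
    case True
    have "deg_tail m L (G n) \<le> deg_tail m K (G n)"
      by (rule deg_tail_antimono) (simp add: L_def)
    also have "\<dots> \<le> vmean (G n) (\<lambda>v. C * ?T K (vdeg (G n) v))"
      unfolding deg_tail_def by (rule vmean_mono) (use \<phi> K(2) in auto)
    also have "\<dots> \<le> \<delta>" unfolding vmean_cmult using N[OF True] by simp
    finally show ?thesis .
  next
    case False
    have "vdeg (G n) v \<le> L" for v
    proof -
      have "vdeg (G n) v \<le> card (verts (G n))"
        unfolding vdeg_def by (rule card_mono[OF finite_G nbrs_subset_verts])
      also have "\<dots> \<le> (\<Sum>n<N. card (verts (G n)))"
        using False by (intro member_le_sum) auto
      finally show ?thesis by (simp add: L_def)
    qed
    then have "\<not> L < vdeg (G n) v" for v by (simp add: not_less)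
    then show ?thesis using \<delta>(1) by (simp add: deg_tail_def vmean_def)
  qed
  then have "(SUP n. ennreal (deg_tail m J (G n))) \<le> ennreal \<delta>" if "L \<le> J" for J
    by (intro SUP_least ennreal_leI order_trans[OF deg_tail_antimono[OF that]])
  then show "\<forall>\<^sub>F K in sequentially. (SUP n. ennreal (deg_tail m K (G n))) < \<epsilon>"
    using \<delta>(2) unfolding eventually_sequentially by (meson le_less_trans)
qed simp

text \<open>Bounded embeddings give the truncated averages: they are local, at most
  \<open>K ^ (card (verts H) - 1)\<close> per root, and increase to the full rooted count.
  Embeddings through high degrees are absorbed by the degree tail.\<close>

lemma emb_mean_tendsto:
  assumes H: "graph_connected H" "finite (verts H)" and u: "u \<in> verts H"
    and tail: "(\<lambda>K. SUP n. ennreal (deg_tail (card (verts H) - 1) K (G n))) \<longlonglongrightarrow> 0"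
  shows "(\<lambda>n. ennreal (real (emb H (G n)) / real (card (verts (G n))))) \<longlonglongrightarrow>
    (\<integral>\<^sup>+\<omega>. ennreal (real (root_emb (H, u) (Gstar \<omega>))) \<partial>M)"
proof -
  let ?m = "card (verts H) - 1"
  \<comment> \<open>The factor \<open>card (verts H)\<close> comes from the choice of the vertex of
    \<open>H\<close> mapped to maximal degree.\<close>
  let ?e = "\<lambda>K. ennreal (card (verts H)) * (SUP n. ennreal (deg_tail ?m K (G n)))"
  obtain R where R: "verts (fst (H, u)) \<subseteq> bverts R (H, u)"
    using connected_radius[of "(H, u)"] H u by auto
  have u': "snd (H, u) \<in> verts (fst (H, u))" using u by simp
  have rep: "loc_finite (fst (rep_gstar X))" for X
    using clf_rep_gstar by (simp add: clf_rgraph_def)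
  have fH: "finite (verts (fst (H, u)))" using H by simp
  have e: "?e \<longlonglongrightarrow> 0"
    using ennreal_tendsto_cmult[OF _ tail, of "ennreal (card (verts H))"] by simp
  show ?thesis
  proof (rule tendsto_nn_integral_if_truncated[OF _ _ _ _ _ _ _ _ e,
      where F = "\<lambda>K X. real (root_bounded_emb K (H, u) X)"
      and f = "\<lambda>K n v. real (bounded_emb K (H, u) (G n) v)" and C = "\<lambda>K. real (K ^ ?m)"])
    show "continuous_on UNIV (\<lambda>X. real (root_bounded_emb K (H, u) X))" for K
      by (rule continuous_on_root_bounded_emb[OF R u'])
    show "real (root_bounded_emb K (H, u) X) \<le> real (K ^ ?m)" for K X
      unfolding root_bounded_emb_def bounded_emb_def
      by (intro of_nat_mono bounded_embs_bound(2)[OF H u rep])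
    show "real (root_bounded_emb K (H, u) (gstar_of (component (G n) v, v))) =
        real (bounded_emb K (H, u) (G n) v)" if "v \<in> verts (G n)" for K n v
      using root_bounded_emb_gstar_of[OF clf_component[OF finite_G that] u', of K]
      by (simp add: bounded_emb_component[OF R])
    show "real (root_bounded_emb K (H, u) X) \<le> real (root_bounded_emb (Suc K) (H, u) X)" for K X
      unfolding root_bounded_emb_def by (intro of_nat_mono bounded_emb_mono[OF fH R rep]) simp
    show "(\<lambda>K. real (root_bounded_emb K (H, u) X)) \<longlonglongrightarrow> real (root_emb (H, u) X)" for X
      unfolding root_bounded_emb_def root_emb_def
      by (rule tendsto_eventually)
        (use bounded_emb_eventually[OF fH R rep[of X], of "snd (rep_gstar X)"] in eventually_elim, simp)
    show "vmean (G n) (\<lambda>v. real (bounded_emb K (H, u) (G n) v)) \<le> real (emb H (G n)) / real (card (verts (G n)))" for K n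
      unfolding vmean_def of_nat_sum[symmetric]
      by (intro divide_right_mono of_nat_mono sum_bounded_emb_le_emb H(2) finite_G u) auto
    show "ennreal (real (emb H (G n)) / real (card (verts (G n)))) \<le>
        ennreal (vmean (G n) (\<lambda>v. real (bounded_emb K (H, u) (G n) v))) + ?e K" for K n
    proof -
      have "real (emb H (G n)) \<le> (\<Sum>v\<in>verts (G n). real (bounded_emb K (H, u) (G n) v)) +
          card (verts H) * (\<Sum>w\<in>{w\<in>verts (G n). K < vdeg (G n) w}. real (vdeg (G n) w) ^ ?m)"
        using of_nat_mono[OF emb_le_sum_bounded_emb[OF H finite_G u, of n K], where 'a = real] by simp
      also have "(\<Sum>w\<in>{w\<in>verts (G n). K < vdeg (G n) w}. real (vdeg (G n) w) ^ ?m) =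
          (\<Sum>w\<in>verts (G n). if K < vdeg (G n) w then real (vdeg (G n) w) ^ ?m else 0)"
        using finite_G by (intro sum.inter_filter)
      finally have "real (emb H (G n)) / real (card (verts (G n))) \<le>
          vmean (G n) (\<lambda>v. real (bounded_emb K (H, u) (G n) v)) + card (verts H) * deg_tail ?m K (G n)"
        unfolding vmean_def deg_tail_def
        by (metis (no_types, lifting) add_divide_distrib divide_right_mono of_nat_0_le_iff times_divide_eq_right)
      then have "ennreal (real (emb H (G n)) / real (card (verts (G n)))) \<le>
          ennreal (vmean (G n) (\<lambda>v. real (bounded_emb K (H, u) (G n) v)) + card (verts H) * deg_tail ?m K (G n))"
        by (rule ennreal_leI)
      also have "\<dots> = ennreal (vmean (G n) (\<lambda>v. real (bounded_emb K (H, u) (G n) v))) +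
          ennreal (card (verts H)) * ennreal (deg_tail ?m K (G n))"
        by (simp add: deg_tail_nonneg vmean_nonneg ennreal_mult del: ennreal_of_nat_eq_real_of_nat)
      also have "\<dots> \<le> ennreal (vmean (G n) (\<lambda>v. real (bounded_emb K (H, u) (G n) v))) + ?e K"
        by (intro add_left_mono mult_left_mono SUP_upper) auto
      finally show ?thesis .
    qed
  qed simp
qed

text \<open>Rooted at its centre, the star turns embedding averages into means of the falling
  factorial of the degree. For \<open>d \<ge> m\<close> this dominates \<open>d ^ m\<close> up to
  the constant \<open>m ^ m\<close>.\<close>

lemma deg_tail_tendsto_if_star_mean:
  assumes "0 < m" and int: "integrable M (\<lambda>\<omega>. real (root_deg (Gstar \<omega>)) ^ m)"
    and star: "(\<lambda>n. ennreal (real (emb (star (Suc m)) (G n)) / real (card (verts (G n))))) \<longlonglongrightarrow>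
      (\<integral>\<^sup>+\<omega>. ennreal (real (root_emb (star (Suc m), 0) (Gstar \<omega>))) \<partial>M)"
  shows "(\<lambda>K. SUP n. ennreal (deg_tail m K (G n))) \<longlonglongrightarrow> 0"
proof (rule deg_tail_tendsto)
  let ?\<phi> = "\<lambda>d. real (\<Prod>i<m. d - i)"
  have "root_emb (star (Suc m), 0) X = (\<Prod>i<m. root_deg X - i)" for X
    unfolding root_emb_def root_deg_def
    using rooted_emb_star[of "Suc m", OF _ rep_gstar_root] clf_rep_gstar[of X] rep_gstar_root[of X]
    by (simp add: clf_rgraph_def loc_finite_def)
  \<comment> \<open>The falling factorial is at most the power, whose integrability is assumed;
    hence the limit of the star counts is a finite expectation.\<close>
  moreover show int': "integrable M (\<lambda>\<omega>. ?\<phi> (root_deg (Gstar \<omega>)))"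
    using falling_factorial_le_power
    by (intro Bochner_Integration.integrable_bound[OF int])
      (auto intro!: borel_measurable_continuous_Gstar continuous_on_root_deg[of ?\<phi>] simp del: of_nat_prod)
  moreover have "real (emb (star (Suc m)) (G n)) / real (card (verts (G n))) =
      vmean (G n) (\<lambda>v. ?\<phi> (vdeg (G n) v))" for n
  proof -
    have "emb (star (Suc m)) (G n) = (\<Sum>v\<in>verts (G n). rooted_emb (star (Suc m), 0) (G n) v)"
      by (rule emb_eq_sum_rooted_emb) (auto simp: finite_G)
    also have "\<dots> = (\<Sum>v\<in>verts (G n). \<Prod>i<m. vdeg (G n) v - i)"
      using loc_finite_G[of n] by (intro sum.cong) (simp_all add: loc_finite_def rooted_emb_star)
    finally show ?thesis by (simp add: vmean_def)
  qed
  ultimately show "(\<lambda>n. vmean (G n) (\<lambda>v. ?\<phi> (vdeg (G n) v))) \<longlonglongrightarrow> (\<integral>\<omega>. ?\<phi> (root_deg (Gstar \<omega>)) \<partial>M)"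
    using star by (simp add: nn_integral_eq_integral vmean_nonneg prod_nonneg)
  show "real d ^ m \<le> real m ^ m * ?\<phi> d" if "m \<le> d" for d
    using that by (rule power_le_falling_factorial)
qed

end

theorem theorem2p1:
  fixes h :: nat and G :: "nat \<Rightarrow> 'a ugraph" and M :: "'w measure" and Gstar :: "'w \<Rightarrow> gstar"
  assumes "h \<ge> 2"
    and "\<And>n. finite (verts (G n))"
    and "\<And>n. card (verts (G n)) \<ge> 1"
    and "filterlim (\<lambda>n. card (verts (G n))) at_top sequentially"
    and "prob_space M"
    and "Gstar \<in> borel_measurable M"
    and "weakly_converges (\<lambda>n. local_law (G n)) (distr M borel Gstar)"
    and "integrable M (\<lambda>\<omega>. real (root_deg (Gstar \<omega>)) ^ (h - 1))"
  shows
    "((\<lambda>n. \<integral>v. real (vdeg (G n) v) ^ (h - 1) \<partial>unif_vertex (G n))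
        \<longlonglongrightarrow> (\<integral>\<omega>. real (root_deg (Gstar \<omega>)) ^ (h - 1) \<partial>M)
      \<longleftrightarrow> uniformly_integrable (\<lambda>n. unif_vertex (G n)) (\<lambda>n v. real (vdeg (G n) v) ^ (h - 1)))
     \<and> (uniformly_integrable (\<lambda>n. unif_vertex (G n)) (\<lambda>n v. real (vdeg (G n) v) ^ (h - 1))
      \<longleftrightarrow> (\<forall>H :: nat ugraph. graph_connected H \<and> card (verts H) = h \<longrightarrow>
            (\<forall>H' \<in> rootings H.
              (\<lambda>n. ennreal (real (emb H (G n)) / real (card (verts (G n)))))
                \<longlonglongrightarrow> (\<integral>\<^sup>+ \<omega>. ennreal (real (root_emb H' (Gstar \<omega>))) \<partial>M))))"
    (is "(?i \<longleftrightarrow> ?ii) \<and> (?ii \<longleftrightarrow> ?iii)")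
proof -
  let ?m = "h - 1"
  have ne: "verts (G n) \<noteq> {}" for n using assms(3)[of n] by auto
  interpret prob_space M by fact
  interpret local_limit M G Gstar
    by unfold_locales (use assms(2,6,7) ne in auto)
  have m: "0 < ?m" "Suc ?m = h" using assms(1) by auto
  \<comment> \<open>All three conditions are compared with this one.\<close>
  let ?tail = "(\<lambda>K. SUP n. ennreal (deg_tail ?m K (G n))) \<longlonglongrightarrow> 0"
  have ii: "?ii \<longleftrightarrow> ?tail"
    by (rule uniformly_integrable_iff_deg_tail[OF m(1) assms(2) ne])
  have i: "?i \<longleftrightarrow> (\<lambda>n. vmean (G n) (\<lambda>v. real (vdeg (G n) v) ^ ?m)) \<longlonglongrightarrow>
      (\<integral>\<omega>. real (root_deg (Gstar \<omega>)) ^ ?m \<partial>M)"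
    by (simp add: integral_unif_vertex[OF assms(2) ne])
  \<comment> \<open>For the forward direction the weight is the power itself, so the constant is
    \<open>1\<close> and the comparison starts at degree \<open>0\<close>.\<close>
  have "?i \<longleftrightarrow> ?ii"
    unfolding i ii
    using deg_mean_tendsto[OF _ assms(8)]
      deg_tail_tendsto[of "\<lambda>d. real d ^ ?m", OF _ assms(8), of 0 ?m 1] by auto
  moreover have ?iii if ?ii
  proof (intro allI impI ballI)
    fix H :: "nat ugraph" and H'
    assume H: "graph_connected H \<and> card (verts H) = h" and "H' \<in> rootings H"
    then obtain u where u: "H' = (H, u)" "u \<in> verts H" by (auto simp: rootings_def)
    \<comment> \<open>Infinite sets have \<open>card\<close> equal to \<open>0\<close>, whereas
      \<open>h\<close> is positive.\<close>
    have "finite (verts H)" using H assms(1) by (intro card_ge_0_finite) simp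
    then show "(\<lambda>n. ennreal (real (emb H (G n)) / real (card (verts (G n)))))
        \<longlonglongrightarrow> (\<integral>\<^sup>+ \<omega>. ennreal (real (root_emb H' (Gstar \<omega>))) \<partial>M)"
      unfolding u(1) using H u(2) that ii by (intro emb_mean_tendsto) auto
  qed
  moreover have ?ii if ?iii
  proof -
    \<comment> \<open>A single instance of the embedding condition is used: the star on
      \<open>h\<close> vertices, rooted at its centre.\<close>
    have "(star h, 0) \<in> rootings (star h)" using assms(1) by (auto simp: rootings_def)
    with that star_connected[of h] assms(1) have
      "(\<lambda>n. ennreal (real (emb (star h) (G n)) / real (card (verts (G n)))))
        \<longlonglongrightarrow> (\<integral>\<^sup>+ \<omega>. ennreal (real (root_emb (star h, 0) (Gstar \<omega>))) \<partial>M)"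
      by simp
    then show ?ii
      unfolding ii using deg_tail_tendsto_if_star_mean[OF m(1) assms(8)] m(2) by simp
  qed
  ultimately show ?thesis by blast
qed

end
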